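(* Let $m\in\mathbb{N}$ and $1\le p<\infty$. The class $\mathcal{P}_{d,p}^+$ of positive $p$-dominated $m$-homogeneous polynomials is a positive right polynomial ideal, obtained through the factorization method from the positive right ideal $\Pi_p^+$ of positive $p$-summing operators: for every Banach lattice $E$ and Banach space $Y$, $$\mathcal{P}_{d,p}^+(^mE;Y)=\mathcal{P}(\Pi_p^+)(^mE;Y).$$
   Context: $\mathcal{L}(X;Y)$ is the space of bounded linear operators between Banach spaces; $\mathcal{L}^+(E;F)$ is the set of positive bounded linear operators between Banach lattices. $\mathcal{P}(^mX;Y)$ is the Banach space of continuous $m$-homogeneous polynomials with $\|P\|=\sup_{\|x\|\le1}\|P(x)\|$. A polynomial is of finite type if it has the form $x\mapsto\sum_{i=1}^k\varphi_i(x)^m y_i$ with $\varphi_i\in X^*$, $y_i\in Y$. $E^+$ is the positive cone of $E$ and $B_{E^*}^+=\{x^*\in E^*:\|x^*\|\le1,\ x^*\ge0\}$. $\Pi_p^+(E;X)$ is the set of positive $p$-summing operators $u:E\to X$ ($E$ a Banach lattice, $X$ a Banach space): those bounded linear $u$ for which there is $C>0$ with $(\sum_{i=1}^n\|u(x_i)\|^p)^{1/p}\le C\sup_{x^*\in B_{E^*}^+}(\sum_{i=1}^n\langle x^*,x_i\rangle^p)^{1/p}$ for all $n$ and $x_1,\dots,x_n\in E^+$. $\mathcal{P}_{d,p}^+(^mE;Y)$ is the set of positive $p$-dominated polynomials: those $P\in\mathcal{P}(^mE;Y)$ for which there is $C>0$ with $(\sum_{i=1}^n\|P(x_i)\|^{p/m})^{m/p}\le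 C\sup_{x^*\in B_{E^*}^+}(\sum_{i=1}^n|x^*(x_i)|^p)^{m/p}$ for all $n$ and $(x_i)_{i=1}^n\subset E^+$. $\mathcal{P}(\Pi_p^+)(^mE;Y)$ is the set of all $P\in\mathcal{P}(^mE;Y)$ of the form $P=Q\circ u$ with $X$ a Banach space, $u\in\Pi_p^+(E;X)$ and $Q\in\mathcal{P}(^mX;Y)$. A positive right polynomial ideal $\mathcal{P}_R^+$ is a class of continuous $m$-homogeneous polynomials from Banach lattices into Banach spaces such that, for every Banach lattice $E$ and Banach space $Y$, $\mathcal{P}_R^+(^mE;Y)$ is a linear subspace of $\mathcal{P}(^mE;Y)$ containing the finite type polynomials, and $v\circ P\circ u\in\mathcal{P}_R^+(^mG;Z)$ whenever $P\in\mathcal{P}_R^+(^mE;Y)$, $u\in\mathcal{L}^+(G;E)$ ($G$ a Banach lattice), $v\in\mathcal{L}(Y;Z)$ ($Z$ a Banach space). *)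

theory Defs
  imports
    "HOL-Analysis.Analysis"
    "HOL-Library.Lattice_Algebras"
    "HOL-Probability.Discrete_Topology"
begin

text \<open>
  The modulus of \<open>lattice_ab_group_add_abs\<close> is \<open>\<bar>x\<bar> = sup x (- x)\<close>, so the class below
  is that of real Banach lattices.
\<close>

class banach_lattice = banach + ordered_real_vector + lattice_ab_group_add_abs +
  assumes norm_mono_abs: "\<bar>x\<bar> \<le> \<bar>y\<bar> \<Longrightarrow> norm x \<le> norm y"

definition positive_dual_ball :: "('e::banach_lattice \<Rightarrow>\<^sub>L real) set"
  where "positive_dual_ball = {\<phi>. norm \<phi> \<le> 1 \<and> (\<forall>x\<ge>0. 0 \<le> blinfun_apply \<phi> x)}"

definition positive_operators :: "('g::banach_lattice \<Rightarrow> 'e::banach_lattice) set"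
  where "positive_operators = {u. bounded_linear u \<and> (\<forall>x\<ge>0. 0 \<le> u x)}"

text \<open>
  A Banach space that is not itself a type of class \<open>banach\<close> is represented by a closed linear
  subspace \<open>X\<close> of such a type; \<open>X = UNIV\<close> gives the type itself.  Maps defined on \<open>X\<close> are total
  functions whose values outside \<open>X\<close> are irrelevant.

  The \<open>m\<close> arguments of an \<open>m\<close>-linear map are given as a list of length \<open>m\<close>.
\<close>

definition multilinear_on ::
    "nat \<Rightarrow> 'x::real_vector set \<Rightarrow> ('x list \<Rightarrow> 'y::real_vector) \<Rightarrow> bool"
  where "multilinear_on m X A \<longleftrightarrow>
    (\<forall>xs ys. length xs + length ys + 1 = m \<longrightarrow> set xs \<subseteq> X \<longrightarrow> set ys \<subseteq> X \<longrightarrow>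
      (\<forall>a\<in>X. \<forall>b\<in>X. A (xs @ (a + b) # ys) = A (xs @ a # ys) + A (xs @ b # ys)) \<and>
      (\<forall>c. \<forall>a\<in>X. A (xs @ (c *\<^sub>R a) # ys) = c *\<^sub>R A (xs @ a # ys)))"

definition hom_polys ::
    "nat \<Rightarrow> 'x::real_normed_vector set \<Rightarrow> ('x \<Rightarrow> 'y::real_normed_vector) set"
  where "hom_polys m X =
    {P. continuous_on X P \<and>
        (\<exists>A. multilinear_on m X A \<and> (\<forall>x\<in>X. P x = A (replicate m x)))}"

definition finite_type_polys ::
    "nat \<Rightarrow> ('x::real_normed_vector \<Rightarrow> 'y::real_normed_vector) set"
  where "finite_type_polys m =
    {P. \<exists>k (\<phi> :: nat \<Rightarrow> 'x \<Rightarrow>\<^sub>L real) y.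
          P = (\<lambda>x. \<Sum>i<k. (blinfun_apply (\<phi> i) x) ^ m *\<^sub>R y i)}"

text \<open>Operators from \<open>'e\<close> into the Banach space \<open>X\<close>.\<close>

definition positive_summing ::
    "real \<Rightarrow> 'x::banach set \<Rightarrow> ('e::banach_lattice \<Rightarrow> 'x) set"
  where "positive_summing p X =
    {u. bounded_linear u \<and> range u \<subseteq> X \<and>
        (\<exists>C>0. \<forall>n (x :: nat \<Rightarrow> 'e). (\<forall>i<n. 0 \<le> x i) \<longrightarrow>
          (\<Sum>i<n. norm (u (x i)) powr p) powr (1 / p)
            \<le> C * (SUP \<phi>\<in>positive_dual_ball. (\<Sum>i<n. blinfun_apply \<phi> (x i) powr p) powr (1 / p)))}"

definition positive_dominated ::
    "nat \<Rightarrow> real \<Rightarrow> ('e::banach_lattice \<Rightarrow> 'y::banach) set"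
  where "positive_dominated m p =
    {P \<in> hom_polys m UNIV.
        \<exists>C>0. \<forall>n (x :: nat \<Rightarrow> 'e). (\<forall>i<n. 0 \<le> x i) \<longrightarrow>
          (\<Sum>i<n. norm (P (x i)) powr (p / real m)) powr (real m / p)
            \<le> C * (SUP \<phi>\<in>positive_dual_ball.
                     (\<Sum>i<n. \<bar>blinfun_apply \<phi> (x i)\<bar> powr p) powr (real m / p))}"

text \<open>
  The factorization method applied to an operator ideal, where \<open>I X\<close> is the component of
  operators from \<open>'e\<close> into \<open>X\<close>.  The intermediate Banach space ranges over the closed subspaces
  of \<open>'x\<close>, since one cannot quantify over types within a formula.
\<close>

definition poly_factorization ::
    "nat \<Rightarrow> ('x::banach set \<Rightarrow> ('e::banach_lattice \<Rightarrow> 'x) set) \<Rightarrow> ('e \<Rightarrow> 'y::banach) set"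
  where "poly_factorization m I =
    {P \<in> hom_polys m UNIV.
        \<exists>X. closed X \<and> subspace X \<and> (\<exists>u\<in>I X. \<exists>Q\<in>hom_polys m X. P = Q \<circ> u)}"

text \<open>
  The space \<open>\<ell>\<^sub>\<infinity>('a)\<close> of all bounded real functions on \<open>'a\<close>.  Up to isometry, its closed
  subspaces include all Banach spaces that have a dense subset indexed by \<open>'a\<close>; in particular,
  for an operator \<open>u\<close> on \<open>'e\<close>, the closure of the range of \<open>u\<close> is one of the closed subspaces
  of \<open>\<ell>\<^sub>\<infinity>('e)\<close>.
\<close>

instance bcontfun :: (metric_space, banach) banach ..

type_synonym 'a linfty = "'a discrete \<Rightarrow>\<^sub>C real"

text \<open>
  The conditions on a positive right polynomial ideal that involve the Banach lattices
  \<open>'e\<close>, \<open>'g\<close> and the Banach spaces \<open>'y\<close>, \<open>'z\<close>; \<open>R\<close> and \<open>R'\<close> are the components of the class at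
  \<open>('e, 'y)\<close> and \<open>('g, 'z)\<close>.  A class is an ideal iff this holds for all choices of the types.
\<close>

definition positive_right_polynomial_ideal ::
    "nat \<Rightarrow> ('e::banach_lattice \<Rightarrow> 'y::banach) set \<Rightarrow> ('g::banach_lattice \<Rightarrow> 'z::banach) set \<Rightarrow> bool"
  where "positive_right_polynomial_ideal m R R' \<longleftrightarrow>
    R \<subseteq> hom_polys m UNIV \<and>
    (\<lambda>x. 0) \<in> R \<and>
    (\<forall>P\<in>R. \<forall>Q\<in>R. (\<lambda>x. P x + Q x) \<in> R) \<and>
    (\<forall>c. \<forall>P\<in>R. (\<lambda>x. c *\<^sub>R P x) \<in> R) \<and>
    finite_type_polys m \<subseteq> R \<and>
    (\<forall>P\<in>R. \<forall>u\<in>positive_operators. \<forall>v. bounded_linear v \<longrightarrow> v \<circ> P \<circ> u \<in> R')"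

end

(*
  Domination of P by p-th powers of positive functionals, together with the Mazur-Orlicz theorem,
  yields a positive functional L on the bounded functions on B = {phi in E*: norm phi <= 1, phi >= 0}
  with norm (P x) <= C * q x ^ m for x >= 0, where q x = L (phi |-> phi |x| powr p) powr (1/p)
  (Pietsch).  P is dominated only on the positive cone, hence the modulus in q: it makes q a lattice
  seminorm, so that splitting arguments into positive and negative parts costs only a constant,
  which fails for L (phi |-> |phi x| powr p) powr (1/p).  The polarization formula needs P only at sums
  of its arguments, hence on the positive cone, so the symmetric m-linear form of P is continuous
  with respect to q and extends to the completion of (E, q), realized as the closure of the range
  of an operator u from E into a space of bounded functions with norm (u x) = q x.
*)

theory Submission
  imports Defs "HOL-Combinatorics.Multiset_Permutations"
begin

section \<open>Sublinear functionals\<close>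

text \<open>The exponent \<open>p / m\<close> may be smaller than 1, so the left-hand side of the
  domination inequality offers no convexity to separate with. The separation is instead made for
  pairs (moment function, sum of powers of norms) indexed by finite lists of positive vectors.
  Concatenating lists adds pairs, and since \<open>P\<close> is homogeneous, scaling all vectors by
  \<open>t powr (1 / p)\<close> multiplies both entries by \<open>t\<close>. So the pairs form a
  convex cone, which is what the Mazur-Orlicz theorem takes as input. The \<open>m\<close>-linear
  form that comes with \<open>P\<close> is arbitrary; only its symmetrization is determined by
  \<open>P\<close>. Hence all estimates concern \<open>polarization m A\<close> and never
  \<open>A\<close> itself. These estimates also show that the symmetrization ignores vectors of zero
  \<open>q\<close>, so that it descends along the possibly non-injective \<open>u\<close>. The same
  Hahn-Banach core serves three times: for the functional L, for dominating a functional by a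
  positive one on the cone, and for the coordinates of \<open>u\<close>.\<close>

definition sublinear :: "('v::real_vector \<Rightarrow> real) \<Rightarrow> bool"
  where "sublinear s \<longleftrightarrow>
    (\<forall>x y. s (x + y) \<le> s x + s y) \<and> (\<forall>t\<ge>0. \<forall>x. s (t *\<^sub>R x) = t * s x)"

text \<open>Applying the one-sided scaling bound to \<open>1 / t\<close> and
  \<open>t *\<^sub>R x\<close> gives the reverse one. Later proofs thus only bound infima and
  suprema from one side.\<close>

lemma sublinearI:
  assumes "\<And>x y. s (x + y) \<le> s x + s y" and "\<And>t x. 0 < t \<Longrightarrow> s (t *\<^sub>R x) \<le> t * s x" and "s 0 = 0"
  shows "sublinear s"
proof -
  have "s (t *\<^sub>R x) = t * s x" if "0 < t" for t x
  proof (rule antisym)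
    have "s ((1 / t) *\<^sub>R (t *\<^sub>R x)) \<le> (1 / t) * s (t *\<^sub>R x)"
      using that by (intro assms(2)) simp
    then show "t * s x \<le> s (t *\<^sub>R x)"
      using that by (simp add: field_simps)
  qed (use that assms(2) in blast)
  moreover have "s (0 *\<^sub>R x) = 0 * s x" for x
    using assms(3) by simp
  ultimately show ?thesis
    unfolding sublinear_def using assms(1) by (metis order_le_less)
qed

lemma sublinear_add: "sublinear s \<Longrightarrow> s (x + y) \<le> s x + s y"
  and sublinear_scaleR: "sublinear s \<Longrightarrow> 0 \<le> t \<Longrightarrow> s (t *\<^sub>R x) = t * s x"
  by (auto simp: sublinear_def)

lemma sublinear_zero: "sublinear s \<Longrightarrow> s 0 = 0"
  using sublinear_scaleR[of s 0 0] by simp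

lemma sublinear_minus: "sublinear s \<Longrightarrow> - s (- x) \<le> s x"
  using sublinear_add[of s x "- x"] sublinear_zero[of s] by simp

text \<open>The common core of three infimum constructions: the perturbation of a minimal
  functional, the infimum of a chain, and the functional in the Mazur-Orlicz theorem.\<close>

lemma sublinear_Inf:
  fixes F :: "'v::real_vector \<Rightarrow> real set"
  assumes bdd: "\<And>x. bdd_below (F x)" and zero: "0 \<in> F 0" and nonneg: "\<And>a. a \<in> F 0 \<Longrightarrow> 0 \<le> a"
    and ne: "\<And>x. F x \<noteq> {}"
    and add: "\<And>x y a b. a \<in> F x \<Longrightarrow> b \<in> F y \<Longrightarrow> \<exists>c\<in>F (x + y). c \<le> a + b"
    and scale: "\<And>t x a. 0 < t \<Longrightarrow> a \<in> F x \<Longrightarrow> \<exists>c\<in>F (t *\<^sub>R x). c \<le> t * a"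
  shows "sublinear (\<lambda>x. Inf (F x))"
proof (rule sublinearI)
  fix x y
  have "Inf (F (x + y)) - b \<le> Inf (F x)" if "b \<in> F y" for b
  proof (rule cInf_greatest[OF ne])
    fix a assume "a \<in> F x"
    then obtain c where "c \<in> F (x + y)" "c \<le> a + b" using add \<open>b \<in> F y\<close> by blast
    then show "Inf (F (x + y)) - b \<le> a"
      using cInf_lower[OF _ bdd] by fastforce
  qed
  then have "Inf (F (x + y)) - Inf (F x) \<le> Inf (F y)"
    by (intro cInf_greatest[OF ne]) (simp add: algebra_simps)
  then show "Inf (F (x + y)) \<le> Inf (F x) + Inf (F y)" by simp
next
  fix t :: real and x assume "0 < t"
  have "Inf (F (t *\<^sub>R x)) / t \<le> Inf (F x)"
  proof (rule cInf_greatest[OF ne])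
    fix a assume "a \<in> F x"
    then obtain c where "c \<in> F (t *\<^sub>R x)" "c \<le> t * a" using scale \<open>0 < t\<close> by blast
    then have "Inf (F (t *\<^sub>R x)) \<le> t * a"
      using cInf_lower[OF _ bdd] by fastforce
    then show "Inf (F (t *\<^sub>R x)) / t \<le> a"
      using \<open>0 < t\<close> by (simp add: field_simps)
  qed
  then show "Inf (F (t *\<^sub>R x)) \<le> t * Inf (F x)"
    using \<open>0 < t\<close> by (simp add: field_simps)
next
  show "Inf (F 0) = 0"
    using zero nonneg by (intro cInf_eq_minimum) auto
qed

text \<open>
  If \<open>q\<close> is a minimal sublinear functional, then it coincides with the sublinear functional
  \<open>x \<mapsto> inf {q (x + t y) - t q y | t \<ge> 0}\<close>, which makes it additive.
\<close>

lemma minimal_sublinear_linear: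
  assumes q: "sublinear q"
    and minimal: "\<And>r. sublinear r \<Longrightarrow> (\<And>x. r x \<le> q x) \<Longrightarrow> r = q"
  shows "linear q"
proof -
  have add: "q x + q y \<le> q (x + y)" for x y
  proof -
    define F where "F = (\<lambda>x. (\<lambda>t. q (x + t *\<^sub>R y) - t * q y) ` {0..})"
    have lower: "- q (- x) \<le> a" if "a \<in> F x" for a x
    proof -
      from that obtain t where t: "0 \<le> t" "a = q (x + t *\<^sub>R y) - t * q y" by (auto simp: F_def)
      have "t * q y = q ((x + t *\<^sub>R y) + (- x))" using sublinear_scaleR[OF q t(1), of y] by simp
      also have "\<dots> \<le> q (x + t *\<^sub>R y) + q (- x)" by (rule sublinear_add[OF q])
      finally show ?thesis using t by simp
    qed
    then have bdd: "bdd_below (F x)" for x by (rule bdd_belowI)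
    have F: "q (x + t *\<^sub>R y) - t * q y \<in> F x" if "0 \<le> t" for t x using that by (auto simp: F_def)
    have "sublinear (\<lambda>x. Inf (F x))"
    proof (rule sublinear_Inf)
      show "0 \<in> F 0" using F[of 0 0] sublinear_zero[OF q] by simp
      show "0 \<le> a" if "a \<in> F 0" for a using lower[OF that] sublinear_zero[OF q] by simp
      show "F x \<noteq> {}" for x using F[of 0 x] by auto
      show "\<exists>c\<in>F (x + z). c \<le> a + b" if ab: "a \<in> F x" "b \<in> F z" for x z a b
      proof -
        from ab obtain t r where t: "0 \<le> t" "a = q (x + t *\<^sub>R y) - t * q y"
          "0 \<le> r" "b = q (z + r *\<^sub>R y) - r * q y" by (auto simp: F_def)
        have "q (x + z + (t + r) *\<^sub>R y) \<le> q (x + t *\<^sub>R y) + q (z + r *\<^sub>R y)"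
          using sublinear_add[OF q, of "x + t *\<^sub>R y" "z + r *\<^sub>R y"] by (simp add: algebra_simps)
        then show ?thesis
          using F[of "t + r" "x + z"] t by (intro bexI[of _ "q (x + z + (t + r) *\<^sub>R y) - (t + r) * q y"]) (auto simp: algebra_simps)
      qed
      show "\<exists>c\<in>F (t *\<^sub>R x). c \<le> t * a" if ta: "0 < t" "a \<in> F x" for t x a
      proof -
        from ta obtain r where r: "0 \<le> r" "a = q (x + r *\<^sub>R y) - r * q y" by (auto simp: F_def)
        have "q (t *\<^sub>R x + (t * r) *\<^sub>R y) = t * q (x + r *\<^sub>R y)"
          using sublinear_scaleR[OF q, of t "x + r *\<^sub>R y"] ta(1) by (simp add: algebra_simps)
        then show ?thesis
          using F[of "t * r" "t *\<^sub>R x"] r ta(1)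
          by (intro bexI[of _ "q (t *\<^sub>R x + (t * r) *\<^sub>R y) - (t * r) * q y"]) (auto simp: right_diff_distrib)
      qed
    qed (rule bdd)
    moreover have "Inf (F x) \<le> q x" for x
      using cInf_lower[OF F[of 0 x] bdd] by simp
    ultimately have "(\<lambda>x. Inf (F x)) = q" by (rule minimal)
    then have "q x = Inf (F x)" by metis
    \<comment> \<open>The member of \<open>F x\<close> with parameter 1. Minimality has turned
      \<open>Inf (F x)\<close> into \<open>q x\<close>, so this is superadditivity.\<close>
    also have "\<dots> \<le> q (x + y) - q y"
      using cInf_lower[OF F[of 1 x] bdd] by simp
    finally show ?thesis by simp
  qed
  then have add: "q (x + y) = q x + q y" for x y
    using sublinear_add[OF q] by (simp add: antisym)
  then have minus: "q (- x) = - q x" for x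
    using add[of x "- x"] sublinear_zero[OF q] by simp
  have "q (t *\<^sub>R x) = t * q x" for t x
    using sublinear_scaleR[OF q, of t x] sublinear_scaleR[OF q, of "- t" x] minus[of "t *\<^sub>R x"]
    by (cases "0 \<le> t") auto
  then show ?thesis using add by (intro linearI) auto
qed

text \<open>Hahn-Banach without extending from subspaces: Zorn's lemma gives a minimal sublinear
  functional below \<open>s\<close>, and minimal ones are linear. The order \<open>P\<close> is
  reversed, so an upper bound of a chain is its pointwise infimum, which is finite because every
  member satisfies \<open>- s (- x) \<le> r x\<close>.\<close>

lemma sublinear_dominates_linear:
  fixes s :: "'v::real_vector \<Rightarrow> real"
  assumes s: "sublinear s"
  obtains L where "linear L" and "\<And>x. L x \<le> s x"
proof -
  define \<A> where "\<A> = {r. sublinear r \<and> (\<forall>x. r x \<le> s x)}"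
  define P where "P = (\<lambda>r r' :: 'v \<Rightarrow> real. \<forall>x. r' x \<le> r x)"
  have "\<exists>q\<in>\<A>. \<forall>r\<in>\<A>. P q r \<longrightarrow> r = q"
  proof (rule predicate_Zorn)
    show "partial_order_on \<A> (relation_of P \<A>)"
      by (rule partial_order_on_relation_ofI) (auto simp: P_def fun_eq_iff intro: order_trans antisym)
    fix C assume C: "C \<in> Chains (relation_of P \<A>)"
    have CA: "C \<subseteq> \<A>" using Chains_relation_of[OF C] .
    show "\<exists>u\<in>\<A>. \<forall>a\<in>C. P a u"
    proof (cases "C = {}")
      case True
      then show ?thesis using s by (auto simp: \<A>_def)
    next
      case False
      define F where "F = (\<lambda>x. (\<lambda>r. r x) ` C)"
      have lower: "- s (- x) \<le> a" if "a \<in> F x" for a x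
      proof -
        from that obtain r where r: "r \<in> C" "a = r x" by (auto simp: F_def)
        with CA have "sublinear r" "r (- x) \<le> s (- x)" by (auto simp: \<A>_def)
        then show ?thesis using sublinear_minus[of r x] r by simp
      qed
      then have bdd: "bdd_below (F x)" for x by (rule bdd_belowI)
      have sub: "sublinear r" if "r \<in> C" for r using that CA by (auto simp: \<A>_def)
      have "sublinear (\<lambda>x. Inf (F x))"
      proof (rule sublinear_Inf)
        show "0 \<in> F 0" using False sub sublinear_zero by (force simp: F_def)
        show "0 \<le> a" if "a \<in> F 0" for a using lower[OF that] sublinear_zero[OF s] by simp
        show "F x \<noteq> {}" for x using False by (auto simp: F_def)
        show "\<exists>c\<in>F (x + z). c \<le> a + b" if ab: "a \<in> F x" "b \<in> F z" for x z a b
        proof -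
          from ab obtain r r' where r: "r \<in> C" "a = r x" "r' \<in> C" "b = r' z" by (auto simp: F_def)
          \<comment> \<open>Subadditivity of the infimum uses that \<open>C\<close> is a chain: the
            smaller of the two functionals is good at both points.\<close>
          with C have "P r r' \<or> P r' r" by (auto simp: Chains_def relation_of_def)
          then obtain r'' where "r'' \<in> C" "r'' x \<le> a" "r'' z \<le> b"
            using r by (auto simp: P_def)
          then show ?thesis
            using sublinear_add[OF sub, of r'' x z] by (intro bexI[of _ "r'' (x + z)"]) (auto simp: F_def)
        qed
        show "\<exists>c\<in>F (t *\<^sub>R x). c \<le> t * a" if "0 < t" "a \<in> F x" for t x a
          using that sublinear_scaleR[OF sub, of _ t] by (force simp: F_def)
      qed (rule bdd)
      moreover have le: "Inf (F x) \<le> r x" if "r \<in> C" for r x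
        using that by (intro cInf_lower bdd) (auto simp: F_def)
      moreover have "Inf (F x) \<le> s x" for x
        using False le CA by (force simp: \<A>_def intro: order_trans)
      ultimately show ?thesis
        by (intro bexI[of _ "\<lambda>x. Inf (F x)"]) (auto simp: P_def \<A>_def)
    qed
  qed
  then obtain q where q: "q \<in> \<A>" and min: "\<And>r. r \<in> \<A> \<Longrightarrow> P q r \<Longrightarrow> r = q" by blast
  have "linear q"
  proof (rule minimal_sublinear_linear)
    show "r = q" if "sublinear r" "\<And>x. r x \<le> q x" for r
      using that q by (intro min) (auto simp: \<A>_def P_def intro: order_trans)
  qed (use q in \<open>simp add: \<A>_def\<close>)
  with q show ?thesis by (intro that[of q]) (auto simp: \<A>_def)
qed

text \<open>The infimum over \<open>D\<close> of \<open>s (x + v) - a\<close> is sublinear. A linear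
  \<open>L\<close> below it has both properties: the pair \<open>(0, 0)\<close> gives
  \<open>L x \<le> s x\<close>, and taking \<open>x = - v\<close> gives
  \<open>L (- v) \<le> s 0 - a = - a\<close>.\<close>

theorem mazur_orlicz:
  fixes s :: "'v::real_vector \<Rightarrow> real"
  assumes s: "sublinear s"
    and zero: "(0, 0) \<in> D"
    and add: "\<And>v a w b. (v, a) \<in> D \<Longrightarrow> (w, b) \<in> D \<Longrightarrow> (v + w, a + b) \<in> D"
    and scale: "\<And>t v a. 0 < t \<Longrightarrow> (v, a) \<in> D \<Longrightarrow> (t *\<^sub>R v, t * a) \<in> D"
    and le: "\<And>v a. (v, a) \<in> D \<Longrightarrow> a \<le> s v"
  obtains L where "linear L" and "\<And>x. L x \<le> s x" and "\<And>v a. (v, a) \<in> D \<Longrightarrow> a \<le> L v"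
proof -
  define F where "F = (\<lambda>x. {s (x + v) - a | v a. (v, a) \<in> D})"
  have F: "s (x + v) - a \<in> F x" if "(v, a) \<in> D" for x v a
    using that by (auto simp: F_def)
  have lower: "- s (- x) \<le> c" if "c \<in> F x" for c x
  proof -
    from that obtain v a where va: "(v, a) \<in> D" "c = s (x + v) - a" by (auto simp: F_def)
    show ?thesis using le[OF va(1)] sublinear_add[OF s, of "x + v" "- x"] va(2) by simp
  qed
  then have bdd: "bdd_below (F x)" for x by (rule bdd_belowI)
  have "sublinear (\<lambda>x. Inf (F x))"
  proof (rule sublinear_Inf)
    show "0 \<in> F 0" using F[OF zero, of 0] sublinear_zero[OF s] by simp
    show "0 \<le> a" if "a \<in> F 0" for a using lower[OF that] sublinear_zero[OF s] by simp
    show "F x \<noteq> {}" for x using F[OF zero, of x] by auto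
    show "\<exists>c\<in>F (x + z). c \<le> a + b" if ab: "a \<in> F x" "b \<in> F z" for x z a b
    proof -
      from ab obtain v c w d where v: "(v, c) \<in> D" "a = s (x + v) - c" "(w, d) \<in> D" "b = s (z + w) - d"
        by (auto simp: F_def)
      have "s (x + z + (v + w)) \<le> s (x + v) + s (z + w)"
        using sublinear_add[OF s, of "x + v" "z + w"] by (simp add: algebra_simps)
      then show ?thesis using F[OF add[OF v(1,3)], of "x + z"] v by (intro bexI) auto
    qed
    show "\<exists>c\<in>F (t *\<^sub>R x). c \<le> t * a" if ta: "0 < t" "a \<in> F x" for t x a
    proof -
      from ta obtain v c where v: "(v, c) \<in> D" "a = s (x + v) - c" by (auto simp: F_def)
      have "s (t *\<^sub>R x + t *\<^sub>R v) = t * s (x + v)"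
        using sublinear_scaleR[OF s, of t "x + v"] ta(1) by (simp add: algebra_simps)
      then show ?thesis using F[OF scale[OF ta(1) v(1)], of "t *\<^sub>R x"] v by (force simp: algebra_simps)
    qed
  qed (rule bdd)
  then obtain L where L: "linear L" "\<And>x. L x \<le> Inf (F x)"
    by (rule sublinear_dominates_linear) blast
  have "L x \<le> s x" for x
    using L(2)[of x] cInf_lower[OF F[OF zero, of x] bdd] by simp
  moreover have "a \<le> L v" if "(v, a) \<in> D" for v a
    using L(2)[of "- v"] cInf_lower[OF F[OF that, of "- v"] bdd] sublinear_zero[OF s] linear_neg[OF L(1), of v]
    by simp
  ultimately show ?thesis using L(1) that by blast
qed

section \<open>Summing maps on the positive cone\<close>

text \<open>The definitions of summing and dominated maps have the outer exponent inside the
  supremum; this moves it outside, where it can be cancelled. The bound from below is the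
  monotonicity argument for the inverse map, with exponent \<open>1 / a\<close>.\<close>

lemma SUP_powr:
  fixes f :: "'a \<Rightarrow> real"
  assumes "A \<noteq> {}" and "bdd_above (f ` A)" and "\<And>x. x \<in> A \<Longrightarrow> 0 \<le> f x" and "0 < a"
  shows "(SUP x\<in>A. f x powr a) = (SUP x\<in>A. f x) powr a"
proof (rule antisym)
  have le: "f x powr a \<le> (SUP x\<in>A. f x) powr a" if "x \<in> A" for x
    using assms that by (intro powr_mono2) (auto intro: cSUP_upper)
  then show "(SUP x\<in>A. f x powr a) \<le> (SUP x\<in>A. f x) powr a"
    using assms(1) by (intro cSUP_least)
  have bdd: "bdd_above ((\<lambda>x. f x powr a) ` A)"
    using le by (intro bdd_aboveI2)
  have up: "f x powr a \<le> (SUP x\<in>A. f x powr a)" if "x \<in> A" for x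
    using that bdd by (intro cSUP_upper)
  have "f x \<le> (SUP x\<in>A. f x powr a) powr (1 / a)" if "x \<in> A" for x
  proof -
    have "f x = (f x powr a) powr (1 / a)" using assms(3)[OF that] assms(4) by (simp add: powr_powr)
    also have "\<dots> \<le> (SUP x\<in>A. f x powr a) powr (1 / a)"
      using up[OF that] assms(4) by (intro powr_mono2) auto
    finally show ?thesis .
  qed
  then have "(SUP x\<in>A. f x) \<le> (SUP x\<in>A. f x powr a) powr (1 / a)"
    using assms(1) by (intro cSUP_least)
  moreover obtain x where x: "x \<in> A" using assms(1) by blast
  moreover have "0 \<le> (SUP x\<in>A. f x)" using assms(3)[OF x] cSUP_upper[OF x assms(2)] by simp
  ultimately have "(SUP x\<in>A. f x) powr a \<le> ((SUP x\<in>A. f x powr a) powr (1 / a)) powr a"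
    using assms(4) by (intro powr_mono2) auto
  also have "\<dots> = (SUP x\<in>A. f x powr a)"
    using up[OF x] order_trans[OF powr_ge_zero] assms(4) by (simp add: powr_powr)
  finally show "(SUP x\<in>A. f x) powr a \<le> (SUP x\<in>A. f x powr a)" .
qed

section \<open>The positive dual ball and weak moments\<close>

lemma zero_in_positive_dual_ball: "0 \<in> positive_dual_ball"
  by (simp add: positive_dual_ball_def)

lemma positive_dual_ball_nonneg: "\<phi> \<in> positive_dual_ball \<Longrightarrow> 0 \<le> x \<Longrightarrow> 0 \<le> blinfun_apply \<phi> x"
  by (simp add: positive_dual_ball_def)

lemma positive_dual_ball_mono:
  "\<phi> \<in> positive_dual_ball \<Longrightarrow> x \<le> y \<Longrightarrow> blinfun_apply \<phi> x \<le> blinfun_apply \<phi> y"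
  using positive_dual_ball_nonneg[of \<phi> "y - x"] by (simp add: blinfun.diff_right)

lemma positive_dual_ball_le_norm: "\<phi> \<in> positive_dual_ball \<Longrightarrow> \<bar>blinfun_apply \<phi> x\<bar> \<le> norm x"
  using norm_blinfun[of \<phi> x] mult_right_mono[of "norm \<phi>" 1 "norm x"]
  by (simp add: positive_dual_ball_def)

text \<open>The \<open>p\<close>-th power of the weak l_p norm with respect to positive functionals.
  Omitting the outer root keeps the inner sum additive, and lists instead of indexed families turn
  that into additivity under concatenation.\<close>

definition weak_moment :: "real \<Rightarrow> 'e::banach_lattice list \<Rightarrow> real"
  where "weak_moment p xs = (SUP \<phi>\<in>positive_dual_ball. \<Sum>x\<leftarrow>xs. \<bar>blinfun_apply \<phi> x\<bar> powr p)"

lemma bdd_above_weak_moment: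
  assumes "0 \<le> p"
  shows "bdd_above ((\<lambda>\<phi>. \<Sum>x\<leftarrow>xs. \<bar>blinfun_apply \<phi> x\<bar> powr p) ` positive_dual_ball)"
  using assms
  by (intro bdd_aboveI2[of _ _ "\<Sum>x\<leftarrow>xs. norm x powr p"] sum_list_mono powr_mono2 positive_dual_ball_le_norm) auto

lemma weak_moment_upper:
  "0 \<le> p \<Longrightarrow> \<phi> \<in> positive_dual_ball \<Longrightarrow> (\<Sum>x\<leftarrow>xs. \<bar>blinfun_apply \<phi> x\<bar> powr p) \<le> weak_moment p xs"
  unfolding weak_moment_def by (intro cSUP_upper bdd_above_weak_moment)

lemma weak_moment_least:
  "(\<And>\<phi>. \<phi> \<in> positive_dual_ball \<Longrightarrow> (\<Sum>x\<leftarrow>xs. \<bar>blinfun_apply \<phi> x\<bar> powr p) \<le> B) \<Longrightarrow> weak_moment p xs \<le> B"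
  unfolding weak_moment_def using zero_in_positive_dual_ball by (intro cSUP_least) auto

lemma weak_moment_nonneg: "0 \<le> p \<Longrightarrow> 0 \<le> weak_moment p xs"
  using weak_moment_upper[OF _ zero_in_positive_dual_ball, of p xs] by (simp add: sum_list_triv)

text \<open>Covers dominated polynomials (\<open>r = p / m\<close>) and summing operators
  (\<open>r = p\<close>) at once. As \<open>F\<close> is an arbitrary map, stability properties can
  be proved separately from polynomiality.\<close>

definition cone_summing :: "real \<Rightarrow> real \<Rightarrow> ('e::banach_lattice \<Rightarrow> 'y::real_normed_vector) \<Rightarrow> bool"
  where "cone_summing r p F \<longleftrightarrow>
    (\<exists>K. \<forall>xs. (\<forall>x\<in>set xs. 0 \<le> x) \<longrightarrow> (\<Sum>x\<leftarrow>xs. norm (F x) powr r) \<le> K * weak_moment p xs)"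

lemma cone_summingI:
  "(\<And>xs. (\<And>x. x \<in> set xs \<Longrightarrow> 0 \<le> x) \<Longrightarrow> (\<Sum>x\<leftarrow>xs. norm (F x) powr r) \<le> K * weak_moment p xs)
    \<Longrightarrow> cone_summing r p F"
  unfolding cone_summing_def by blast

lemma cone_summingE:
  assumes "cone_summing r p F" and "0 \<le> p"
  obtains K where "0 < K"
    and "\<And>xs. (\<And>x. x \<in> set xs \<Longrightarrow> 0 \<le> x) \<Longrightarrow> (\<Sum>x\<leftarrow>xs. norm (F x) powr r) \<le> K * weak_moment p xs"
proof -
  from assms(1) obtain K
    where K: "\<And>xs. (\<forall>x\<in>set xs. 0 \<le> x) \<longrightarrow> (\<Sum>x\<leftarrow>xs. norm (F x) powr r) \<le> K * weak_moment p xs"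
    unfolding cone_summing_def by blast
  have "(\<Sum>x\<leftarrow>xs. norm (F x) powr r) \<le> max K 1 * weak_moment p xs" if "\<And>x. x \<in> set xs \<Longrightarrow> 0 \<le> x" for xs
    using K[of xs] that mult_right_mono[OF max.cobounded1[of K 1] weak_moment_nonneg[OF assms(2), of xs]]
    by force
  then show ?thesis by (intro that[of "max K 1"]) auto
qed

text \<open>The two sides differ by raising to the power \<open>s / p\<close>, undone by
  \<open>p / s\<close>. The instances used are \<open>s = m\<close> for polynomials and
  \<open>s = 1\<close> for operators.\<close>

lemma cone_summing_iff:
  assumes "0 < p" and "0 < s"
  shows "cone_summing (p / s) p F \<longleftrightarrow>
    (\<exists>C>0. \<forall>n (x :: nat \<Rightarrow> 'e::banach_lattice). (\<forall>i<n. 0 \<le> x i) \<longrightarrow>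
      (\<Sum>i<n. norm (F (x i)) powr (p / s)) powr (s / p)
        \<le> C * (SUP \<phi>\<in>positive_dual_ball. (\<Sum>i<n. \<bar>blinfun_apply \<phi> (x i)\<bar> powr p) powr (s / p)))"
    (is "_ \<longleftrightarrow> (\<exists>C>0. ?R C)")
proof -
  have W: "(SUP \<phi>\<in>positive_dual_ball. (\<Sum>i<n. \<bar>blinfun_apply \<phi> (x i)\<bar> powr p) powr (s / p))
      = weak_moment p (map x [0..<n]) powr (s / p)" for n and x :: "nat \<Rightarrow> 'e"
  proof -
    have eq: "(\<Sum>i<n. \<bar>blinfun_apply \<phi> (x i)\<bar> powr p) = (\<Sum>x\<leftarrow>map x [0..<n]. \<bar>blinfun_apply \<phi> x\<bar> powr p)" for \<phi>
      by (simp add: interv_sum_list_conv_sum_set_nat atLeast0LessThan o_def)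
    show ?thesis
      unfolding weak_moment_def eq using assms zero_in_positive_dual_ball
      by (intro SUP_powr bdd_above_weak_moment) (auto intro!: sum_list_nonneg)
  qed
  have F: "(\<Sum>i<n. norm (F (x i)) powr (p / s)) = (\<Sum>x\<leftarrow>map x [0..<n]. norm (F x) powr (p / s))"
    for n and x :: "nat \<Rightarrow> 'e"
    by (simp add: interv_sum_list_conv_sum_set_nat atLeast0LessThan o_def)
  show ?thesis
  proof
    assume "cone_summing (p / s) p F"
    then obtain K where K: "0 < K"
      "\<And>xs. (\<And>x. x \<in> set xs \<Longrightarrow> 0 \<le> x) \<Longrightarrow> (\<Sum>x\<leftarrow>xs. norm (F x) powr (p / s)) \<le> K * weak_moment p xs"
      using assms by (elim cone_summingE) auto
    have "?R (K powr (s / p))"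
    proof (intro allI impI)
      fix n and x :: "nat \<Rightarrow> 'e" assume "\<forall>i<n. 0 \<le> x i"
      then have "(\<Sum>x\<leftarrow>map x [0..<n]. norm (F x) powr (p / s)) powr (s / p)
          \<le> (K * weak_moment p (map x [0..<n])) powr (s / p)"
        using assms by (intro powr_mono2 K(2) sum_list_nonneg) auto
      then show "(\<Sum>i<n. norm (F (x i)) powr (p / s)) powr (s / p)
        \<le> K powr (s / p) * (SUP \<phi>\<in>positive_dual_ball. (\<Sum>i<n. \<bar>blinfun_apply \<phi> (x i)\<bar> powr p) powr (s / p))"
        unfolding W F using K(1) assms weak_moment_nonneg by (simp add: powr_mult)
    qed
    then show "\<exists>C>0. ?R C" using K(1) by (intro exI[of _ "K powr (s / p)"]) auto
  next
    assume "\<exists>C>0. ?R C"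
    then obtain C where C: "0 < C" "?R C" by blast
    show "cone_summing (p / s) p F"
    proof (rule cone_summingI)
      fix xs :: "'e list" assume xs: "\<And>x. x \<in> set xs \<Longrightarrow> 0 \<le> x"
      let ?a = "\<Sum>x\<leftarrow>xs. norm (F x) powr (p / s)"
      have "?a powr (s / p) \<le> C * weak_moment p xs powr (s / p)"
        using C(2)[unfolded W F, rule_format, of "length xs" "nth xs"] xs by (simp add: map_nth)
      then have "(?a powr (s / p)) powr (p / s) \<le> (C * weak_moment p xs powr (s / p)) powr (p / s)"
        using assms by (intro powr_mono2) auto
      then show "?a \<le> C powr (p / s) * weak_moment p xs"
        using assms C(1) weak_moment_nonneg[of p xs]
        by (simp add: powr_mult powr_powr sum_list_nonneg)
    qed
  qed
qed

lemma positive_dominated_eq: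
  assumes "1 \<le> m" and "1 \<le> p"
  shows "positive_dominated m p = {P \<in> hom_polys m UNIV. cone_summing (p / real m) p P}"
  unfolding positive_dominated_def using assms by (subst cone_summing_iff) auto

lemma positive_summing_eq:
  assumes "1 \<le> p"
  shows "positive_summing p X = {u. bounded_linear u \<and> range u \<subseteq> X \<and> cone_summing p p u}"
proof -
  \<comment> \<open>The definition of summing operators has no modulus under \<open>powr\<close>; on
    positive vectors and positive functionals it makes no difference.\<close>
  have eq: "(SUP \<phi>\<in>positive_dual_ball. (\<Sum>i<n. \<bar>blinfun_apply \<phi> (x i)\<bar> powr p) powr (1 / p))
      = (SUP \<phi>\<in>positive_dual_ball. (\<Sum>i<n. blinfun_apply \<phi> (x i) powr p) powr (1 / p))"
    if "\<forall>i<n. 0 \<le> x i" for n and x :: "nat \<Rightarrow> 'a"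
    using that
    by (intro SUP_cong arg_cong[where f = "\<lambda>a. a powr (1 / p)"] sum.cong) (auto simp: positive_dual_ball_nonneg)
  have "cone_summing p p u \<longleftrightarrow>
    (\<exists>C>0. \<forall>n (x :: nat \<Rightarrow> 'a). (\<forall>i<n. 0 \<le> x i) \<longrightarrow>
      (\<Sum>i<n. norm (u (x i)) powr p) powr (1 / p)
        \<le> C * (SUP \<phi>\<in>positive_dual_ball. (\<Sum>i<n. blinfun_apply \<phi> (x i) powr p) powr (1 / p)))"
    for u :: "'a \<Rightarrow> 'b"
    using cone_summing_iff[of p 1 u] assms by (simp add: eq cong: imp_cong)
  then show ?thesis
    unfolding positive_summing_def by simp
qed

section \<open>Stability of the summing inequality\<close>

lemma cone_summing_zero: "cone_summing r p (\<lambda>x. 0)"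
  by (rule cone_summingI[of _ _ 0]) (simp add: sum_list_triv)

lemma cone_summing_bounded:
  assumes "cone_summing r p F" and "\<And>x. 0 \<le> x \<Longrightarrow> norm (G x) \<le> B * norm (F x)"
    and "0 \<le> B" and "0 \<le> r" and "0 \<le> p"
  shows "cone_summing r p G"
proof -
  obtain K where K: "0 < K"
      "\<And>xs. (\<And>x. x \<in> set xs \<Longrightarrow> 0 \<le> x) \<Longrightarrow> (\<Sum>x\<leftarrow>xs. norm (F x) powr r) \<le> K * weak_moment p xs"
    using assms by (elim cone_summingE) auto
  show ?thesis
  proof (rule cone_summingI)
    fix xs :: "'a list" assume xs: "\<And>x. x \<in> set xs \<Longrightarrow> 0 \<le> x"
    have "(\<Sum>x\<leftarrow>xs. norm (G x) powr r) \<le> (\<Sum>x\<leftarrow>xs. B powr r * norm (F x) powr r)"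
    proof (rule sum_list_mono)
      fix x assume "x \<in> set xs"
      then have "norm (G x) powr r \<le> (B * norm (F x)) powr r"
        using xs assms by (intro powr_mono2) auto
      then show "norm (G x) powr r \<le> B powr r * norm (F x) powr r"
        using assms(3) by (simp add: powr_mult)
    qed
    also have "\<dots> = B powr r * (\<Sum>x\<leftarrow>xs. norm (F x) powr r)"
      by (rule sum_list_const_mult)
    also have "\<dots> \<le> B powr r * (K * weak_moment p xs)"
      by (intro mult_left_mono K(2) xs) auto
    finally show "(\<Sum>x\<leftarrow>xs. norm (G x) powr r) \<le> (B powr r * K) * weak_moment p xs"
      by (simp add: mult.assoc)
  qed
qed

text \<open>From \<open>a + b \<le> 2 * max a b\<close>. This crude constant works on both sides of
  \<open>r = 1\<close>, whereas the exponent \<open>p / m\<close> may make Minkowski's inequality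
  fail.\<close>

lemma powr_add_le:
  fixes a b :: real
  assumes "0 \<le> a" and "0 \<le> b" and "0 \<le> r"
  shows "(a + b) powr r \<le> 2 powr r * (a powr r + b powr r)"
proof -
  have "(a + b) powr r \<le> (2 * max a b) powr r"
    using assms by (intro powr_mono2) auto
  also have "\<dots> = 2 powr r * max a b powr r" using assms by (simp add: powr_mult)
  also have "\<dots> \<le> 2 powr r * (a powr r + b powr r)"
    by (intro mult_left_mono) (auto simp: max_def)
  finally show ?thesis .
qed

lemma cone_summing_add:
  assumes "cone_summing r p F" and "cone_summing r p G" and "0 \<le> r" and "0 \<le> p"
  shows "cone_summing r p (\<lambda>x. F x + G x)"
proof -
  obtain K where K:
      "\<And>xs. (\<And>x. x \<in> set xs \<Longrightarrow> 0 \<le> x) \<Longrightarrow> (\<Sum>x\<leftarrow>xs. norm (F x) powr r) \<le> K * weak_moment p xs"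
    using cone_summingE[OF assms(1,4)] by blast
  obtain L where L:
      "\<And>xs. (\<And>x. x \<in> set xs \<Longrightarrow> 0 \<le> x) \<Longrightarrow> (\<Sum>x\<leftarrow>xs. norm (G x) powr r) \<le> L * weak_moment p xs"
    using cone_summingE[OF assms(2,4)] by blast
  show ?thesis
  proof (rule cone_summingI)
    fix xs :: "'a list" assume xs: "\<And>x. x \<in> set xs \<Longrightarrow> 0 \<le> x"
    have "(\<Sum>x\<leftarrow>xs. norm (F x + G x) powr r)
        \<le> (\<Sum>x\<leftarrow>xs. 2 powr r * (norm (F x) powr r + norm (G x) powr r))"
    proof (rule sum_list_mono)
      fix x
      have "norm (F x + G x) powr r \<le> (norm (F x) + norm (G x)) powr r"
        using assms by (intro powr_mono2 norm_triangle_ineq) auto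
      also have "\<dots> \<le> 2 powr r * (norm (F x) powr r + norm (G x) powr r)"
        using assms by (intro powr_add_le) auto
      finally show "norm (F x + G x) powr r \<le> 2 powr r * (norm (F x) powr r + norm (G x) powr r)" .
    qed
    also have "\<dots> = 2 powr r * ((\<Sum>x\<leftarrow>xs. norm (F x) powr r) + (\<Sum>x\<leftarrow>xs. norm (G x) powr r))"
      by (simp add: sum_list_const_mult sum_list_addf)
    also have "\<dots> \<le> 2 powr r * (K * weak_moment p xs + L * weak_moment p xs)"
      by (intro mult_left_mono add_mono K L xs) auto
    finally show "(\<Sum>x\<leftarrow>xs. norm (F x + G x) powr r) \<le> (2 powr r * (K + L)) * weak_moment p xs"
      by (simp add: algebra_simps)
  qed
qed

lemma weak_moment_positive_operator:
  assumes u: "u \<in> positive_operators" and "0 \<le> p"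
  obtains B where "0 \<le> B" and "\<And>xs. weak_moment p (map u xs) \<le> B * weak_moment p xs"
proof -
  have lin: "bounded_linear u" using u by (simp add: positive_operators_def)
  \<comment> \<open>The summand 1 allows division by \<open>b\<close> even if \<open>u\<close>
    vanishes. Since \<open>u\<close> is positive, composing with it and dividing by \<open>b\<close>
    keeps functionals in the positive dual ball.\<close>
  define b where "b = onorm u + 1"
  have b: "0 < b" using onorm_pos_le[OF lin] by (simp add: b_def)
  have "weak_moment p (map u xs) \<le> b powr p * weak_moment p xs" for xs
  proof (rule weak_moment_least)
    fix \<phi> :: "'b \<Rightarrow>\<^sub>L real" assume \<phi>: "\<phi> \<in> positive_dual_ball"
    define \<psi> where "\<psi> = (1 / b) *\<^sub>R (\<phi> o\<^sub>L Blinfun u)"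
    have \<psi>_apply: "blinfun_apply \<psi> x = blinfun_apply \<phi> (u x) / b" for x
      by (simp add: \<psi>_def blinfun.scaleR_left bounded_linear_Blinfun_apply[OF lin])
    have "\<psi> \<in> positive_dual_ball"
    proof -
      have "norm (\<phi> o\<^sub>L Blinfun u) \<le> norm \<phi> * norm (Blinfun u)" by (rule norm_blinfun_compose)
      also have "\<dots> \<le> 1 * onorm u"
        using \<phi> by (intro mult_mono)
          (auto simp: positive_dual_ball_def norm_blinfun.rep_eq bounded_linear_Blinfun_apply[OF lin] onorm_pos_le[OF lin])
      finally have "norm \<psi> \<le> 1" using b by (simp add: \<psi>_def b_def)
      moreover have "0 \<le> blinfun_apply \<psi> x" if "0 \<le> x" for x
        using \<phi> u b that by (auto simp: \<psi>_apply positive_operators_def intro!: divide_nonneg_pos positive_dual_ball_nonneg)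
      ultimately show ?thesis by (simp add: positive_dual_ball_def)
    qed
    then have "b powr p * (\<Sum>x\<leftarrow>xs. \<bar>blinfun_apply \<psi> x\<bar> powr p) \<le> b powr p * weak_moment p xs"
      using assms by (intro mult_left_mono weak_moment_upper) auto
    also have "b powr p * (\<Sum>x\<leftarrow>xs. \<bar>blinfun_apply \<psi> x\<bar> powr p)
        = (\<Sum>x\<leftarrow>map u xs. \<bar>blinfun_apply \<phi> x\<bar> powr p)"
      using b by (simp add: sum_list_const_mult[symmetric] \<psi>_apply abs_divide powr_divide o_def)
    finally show "(\<Sum>x\<leftarrow>map u xs. \<bar>blinfun_apply \<phi> x\<bar> powr p) \<le> b powr p * weak_moment p xs" .
  qed
  then show ?thesis by (intro that[of "b powr p"]) auto
qed

lemma cone_summing_compose_positive: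
  assumes "cone_summing r p F" and u: "u \<in> positive_operators" and "0 \<le> p"
  shows "cone_summing r p (F \<circ> u)"
proof -
  obtain K where K: "0 < K"
      "\<And>xs. (\<And>x. x \<in> set xs \<Longrightarrow> 0 \<le> x) \<Longrightarrow> (\<Sum>x\<leftarrow>xs. norm (F x) powr r) \<le> K * weak_moment p xs"
    using cone_summingE[OF assms(1,3)] by blast
  obtain B where B: "0 \<le> B" "\<And>xs. weak_moment p (map u xs) \<le> B * weak_moment p xs"
    using weak_moment_positive_operator[OF u assms(3)] by blast
  show ?thesis
  proof (rule cone_summingI)
    fix xs :: "'c list" assume xs: "\<And>x. x \<in> set xs \<Longrightarrow> 0 \<le> x"
    have "(\<Sum>x\<leftarrow>map u xs. norm (F x) powr r) \<le> K * weak_moment p (map u xs)"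
      using xs u by (intro K) (auto simp: positive_operators_def)
    also have "\<dots> \<le> K * (B * weak_moment p xs)"
      using K(1) B(2) by (intro mult_left_mono) auto
    finally show "(\<Sum>x\<leftarrow>xs. norm ((F \<circ> u) x) powr r) \<le> (K * B) * weak_moment p xs"
      by (simp add: o_def mult.assoc)
  qed
qed

text \<open>Replaces the modulus of \<open>\<phi>\<close> given by the Riesz--Kantorovich formula.\<close>

lemma positive_functional_dominating:
  fixes \<phi> :: "'e::banach_lattice \<Rightarrow>\<^sub>L real"
  assumes "norm \<phi> \<le> 1"
  obtains \<psi> where "\<psi> \<in> positive_dual_ball"
    and "\<And>x. 0 \<le> x \<Longrightarrow> blinfun_apply \<phi> x \<le> blinfun_apply \<psi> x"
proof -
  have pprt_add: "pprt (x + y) \<le> pprt x + pprt y" for x y :: 'e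
    unfolding pprt_def by (intro sup_least add_mono add_nonneg_nonneg) auto
  have mono: "norm x \<le> norm y" if "0 \<le> x" "x \<le> y" for x y :: 'e
    using that by (intro norm_mono_abs) auto
  have pprt_scaleR: "pprt (t *\<^sub>R x) \<le> t *\<^sub>R pprt x" if "0 < t" for t :: real and x :: 'e
    using that unfolding pprt_def by (intro sup_least scaleR_left_mono scaleR_nonneg_nonneg) auto
  \<comment> \<open>Being dominated by the norm of the positive part encodes two demands on
    \<open>L\<close>: it gives \<open>L (- x) \<le> 0\<close> for \<open>x \<ge> 0\<close>, hence
    positivity, and \<open>L x \<le> norm x\<close>, hence norm at most 1. On the cone
    \<open>s\<close> is the norm, so \<open>\<phi>\<close> lies below it there, and \<open>D\<close>
    asks for \<open>\<phi> \<le> L\<close> on the cone.\<close>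
  define s where "s = (\<lambda>x :: 'e. norm (pprt x))"
  have s: "sublinear s"
  proof (rule sublinearI)
    show "s (x + y) \<le> s x + s y" for x y
      unfolding s_def by (rule order_trans[OF mono norm_triangle_ineq]) (auto simp: pprt_add)
    show "s (t *\<^sub>R x) \<le> t * s x" if "0 < t" for t x
      using mono[OF zero_le_pprt pprt_scaleR[OF that, of x]] that by (simp add: s_def)
    show "s 0 = 0" by (simp add: s_def)
  qed
  have le: "blinfun_apply \<phi> x \<le> norm x" for x
    using norm_blinfun[of \<phi> x] mult_right_mono[OF assms, of "norm x"] by simp
  define D where "D = {(x, blinfun_apply \<phi> x) | x. 0 \<le> x}"
  obtain L where L: "linear L" "\<And>x. L x \<le> s x" "\<And>v a. (v, a) \<in> D \<Longrightarrow> a \<le> L v"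
  proof (rule mazur_orlicz[of s D])
    show "a \<le> s v" if "(v, a) \<in> D" for v a
      using that le by (auto simp: D_def s_def)
  qed (use s in \<open>auto simp: D_def blinfun.add_right blinfun.scaleR_right scaleR_nonneg_nonneg\<close>)
  have s_le: "s x \<le> norm x" for x
    using norm_mono_abs[of "pprt x" x] by (simp add: s_def abs_prts)
  have "\<bar>L x\<bar> \<le> norm x" for x
    using L(2)[of x] L(2)[of "- x"] s_le[of x] s_le[of "- x"] linear_neg[OF L(1), of x] by simp
  then have bl: "bounded_linear L" and on: "onorm L \<le> 1"
    using L(1) by (auto intro!: bounded_linear_intro[of L 1] onorm_bound simp: linear_add linear_scale)
  show ?thesis
  proof (rule that[of "Blinfun L"])
    have "0 \<le> L x" if "0 \<le> x" for x
      using L(2)[of "- x"] that linear_neg[OF L(1), of x] by (simp add: s_def)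
    then show "Blinfun L \<in> positive_dual_ball"
      using on by (simp add: positive_dual_ball_def norm_blinfun.rep_eq bounded_linear_Blinfun_apply[OF bl])
    show "blinfun_apply \<phi> x \<le> blinfun_apply (Blinfun L) x" if "0 \<le> x" for x
      using L(3) that by (auto simp: D_def bounded_linear_Blinfun_apply[OF bl])
  qed
qed

text \<open>Put finite type polynomials into the class. Positive functionals in the dual ball are
  summing by the definition of \<open>weak_moment\<close>; for general \<open>\<phi>\<close>, both
  signs of \<open>\<phi> / b\<close> are dominated on the cone by such functionals, so their sum
  dominates the modulus of \<open>\<phi> x / b\<close>.\<close>

lemma cone_summing_functional:
  fixes \<phi> :: "'e::banach_lattice \<Rightarrow>\<^sub>L real"
  assumes "0 \<le> p"
  shows "cone_summing p p (blinfun_apply \<phi>)"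
proof -
  define b where "b = norm \<phi> + 1"
  have b: "0 < b" "norm \<phi> \<le> b" by (auto simp: b_def add_nonneg_pos)
  have norm: "norm ((1 / b) *\<^sub>R \<phi>) \<le> 1" "norm (- ((1 / b) *\<^sub>R \<phi>)) \<le> 1"
    using b by auto
  obtain \<psi> \<eta> where \<psi>: "\<psi> \<in> positive_dual_ball"
      "\<And>x. 0 \<le> x \<Longrightarrow> blinfun_apply ((1 / b) *\<^sub>R \<phi>) x \<le> blinfun_apply \<psi> x"
    and \<eta>: "\<eta> \<in> positive_dual_ball"
      "\<And>x. 0 \<le> x \<Longrightarrow> blinfun_apply (- ((1 / b) *\<^sub>R \<phi>)) x \<le> blinfun_apply \<eta> x"
    using positive_functional_dominating[OF norm(1)] positive_functional_dominating[OF norm(2)] by metis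
  have ball: "cone_summing p p (blinfun_apply \<theta>)" if "\<theta> \<in> positive_dual_ball" for \<theta> :: "'e \<Rightarrow>\<^sub>L real"
    using weak_moment_upper[OF assms that] by (intro cone_summingI[of _ _ 1]) auto
  show ?thesis
  proof (rule cone_summing_bounded[of p p "\<lambda>x. blinfun_apply \<psi> x + blinfun_apply \<eta> x" _ b])
    show "cone_summing p p (\<lambda>x. blinfun_apply \<psi> x + blinfun_apply \<eta> x)"
      using assms by (intro cone_summing_add ball \<psi> \<eta>)
    show "norm (blinfun_apply \<phi> x) \<le> b * norm (blinfun_apply \<psi> x + blinfun_apply \<eta> x)" if x: "0 \<le> x" for x
    proof -
      have "\<bar>blinfun_apply \<phi> x / b\<bar> \<le> blinfun_apply \<psi> x + blinfun_apply \<eta> x"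
        using \<psi>(2)[OF x] \<eta>(2)[OF x] positive_dual_ball_nonneg[OF \<psi>(1) x] positive_dual_ball_nonneg[OF \<eta>(1) x]
        by (auto simp: blinfun.scaleR_left blinfun.minus_left abs_le_iff)
      also have "\<dots> \<le> norm (blinfun_apply \<psi> x + blinfun_apply \<eta> x)"
        by simp
      finally show ?thesis using b(1) by (simp add: abs_divide pos_divide_le_eq mult.commute)
    qed
  qed (use b assms in auto)
qed

section \<open>Homogeneous polynomials\<close>

lemma multilinear_on_add:
  assumes "multilinear_on m X A" and "length xs + length ys + 1 = m"
    and "set xs \<subseteq> X" and "set ys \<subseteq> X" and "a \<in> X" and "b \<in> X"
  shows "A (xs @ (a + b) # ys) = A (xs @ a # ys) + A (xs @ b # ys)"
  using assms unfolding multilinear_on_def by blast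

lemma multilinear_on_scaleR:
  assumes "multilinear_on m X A" and "length xs + length ys + 1 = m"
    and "set xs \<subseteq> X" and "set ys \<subseteq> X" and "a \<in> X"
  shows "A (xs @ (c *\<^sub>R a) # ys) = c *\<^sub>R A (xs @ a # ys)"
  using assms unfolding multilinear_on_def by blast

lemma multilinear_on_diff:
  assumes "multilinear_on m X A" and "length xs + length ys + 1 = m" and "subspace X"
    and "set xs \<subseteq> X" and "set ys \<subseteq> X" and "a \<in> X" and "b \<in> X"
  shows "A (xs @ (a - b) # ys) = A (xs @ a # ys) - A (xs @ b # ys)"
  using multilinear_on_add[OF assms(1,2,4,5), of "a - b" b] assms(3,6,7)
  by (simp add: subspace_diff algebra_simps)

lemma multilinear_on_replicate_scaleR:
  assumes A: "multilinear_on m X A" and X: "subspace X" and x: "x \<in> X"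
  shows "A (replicate m (c *\<^sub>R x)) = c ^ m *\<^sub>R A (replicate m x)"
proof -
  have cx: "c *\<^sub>R x \<in> X" using X x by (rule subspace_scale)
  have "A (replicate k (c *\<^sub>R x) @ replicate j x) = c ^ k *\<^sub>R A (replicate m x)" if "k + j = m" for k j
    using that
  proof (induction k arbitrary: j)
    case (Suc k)
    have "A (replicate (Suc k) (c *\<^sub>R x) @ replicate j x) = A (replicate k (c *\<^sub>R x) @ (c *\<^sub>R x) # replicate j x)"
      by (simp add: replicate_app_Cons_same)
    also have "\<dots> = c *\<^sub>R A (replicate k (c *\<^sub>R x) @ x # replicate j x)"
      using Suc.prems x cx by (intro multilinear_on_scaleR[OF A]) auto
    also have "\<dots> = c *\<^sub>R c ^ k *\<^sub>R A (replicate m x)"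
      using Suc.IH[of "Suc j"] Suc.prems by simp
    finally show ?case by simp
  qed simp
  from this[of m 0] show ?thesis by simp
qed

lemma hom_polys_homogeneous:
  assumes "P \<in> hom_polys m X" and "subspace X" and "x \<in> X"
  shows "P (c *\<^sub>R x) = c ^ m *\<^sub>R P x"
proof -
  obtain A where A: "multilinear_on m X A" "\<And>x. x \<in> X \<Longrightarrow> P x = A (replicate m x)"
    using assms(1) unfolding hom_polys_def by blast
  show ?thesis
    using multilinear_on_replicate_scaleR[OF A(1) assms(2,3), of c] A(2) assms(2,3)
    by (simp add: subspace_scale)
qed

lemma hom_polys_bound:
  assumes Q: "Q \<in> hom_polys m X" and X: "subspace X" and m: "1 \<le> m"
  obtains K where "0 \<le> K" and "\<And>z. z \<in> X \<Longrightarrow> norm (Q z) \<le> K * norm z ^ m"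
proof -
  have X0: "0 \<in> X" using X by (rule subspace_0)
  \<comment> \<open>Here \<open>1 \<le> m\<close> enters: for degree 0 the power
    \<open>0 ^ 0\<close> is 1.\<close>
  have Q0: "Q 0 = 0" using hom_polys_homogeneous[OF Q X X0, of 0] m by (simp add: power_0_left)
  have "continuous_on X Q" using Q by (simp add: hom_polys_def)
  then obtain d where d: "0 < d" "\<And>z. z \<in> X \<Longrightarrow> dist z 0 < d \<Longrightarrow> dist (Q z) (Q 0) < 1"
    using X0 unfolding continuous_on_iff by (meson zero_less_one)
  have "norm (Q z) \<le> (2 / d) ^ m * norm z ^ m" if z: "z \<in> X" for z
  proof (cases "z = 0")
    case True
    then show ?thesis using Q0 d(1) by simp
  next
    case False
    \<comment> \<open>Brings \<open>z\<close> to norm \<open>d / 2\<close>, strictly inside the ball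
      where \<open>norm (Q z) < 1\<close>; homogeneity turns this into the constant
      \<open>(2 / d) ^ m\<close>.\<close>
    define t where "t = d / (2 * norm z)"
    have t: "0 < t" using d False by (simp add: t_def)
    have "norm (t *\<^sub>R z) < d" using d(1) False by (simp add: t_def)
    then have "norm (Q (t *\<^sub>R z)) < 1" using d(2)[of "t *\<^sub>R z"] Q0 X z by (simp add: subspace_scale)
    then have "t ^ m * norm (Q z) < 1" using t by (simp add: hom_polys_homogeneous[OF Q X z])
    then have "norm (Q z) \<le> (1 / t) ^ m" using t by (simp add: field_simps power_divide)
    also have "1 / t = 2 / d * norm z" by (simp add: t_def)
    finally show ?thesis by (simp only: power_mult_distrib)
  qed
  then show ?thesis using d(1) by (intro that[of "(2 / d) ^ m"]) auto
qed

lemma power_powr_divide: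
  fixes a :: real
  assumes "0 \<le> a" and "1 \<le> m"
  shows "(a ^ m) powr (p / real m) = a powr p"
proof (cases "a = 0")
  case False
  then have "a ^ m = a powr real m" using assms(1) by (simp add: powr_realpow)
  then show ?thesis using assms by (simp add: powr_powr)
qed (use assms in simp)

text \<open>Explains the exponent \<open>p / m\<close>: it cancels the \<open>m\<close>-th power.
  Used for \<open>Q \<circ> u\<close> with a bounded polynomial \<open>Q\<close> and for powers of
  functionals.\<close>

lemma cone_summing_power:
  assumes "cone_summing p p F" and "\<And>x. 0 \<le> x \<Longrightarrow> norm (G x) \<le> K * norm (F x) ^ m"
    and "0 \<le> K" and "1 \<le> m" and "0 \<le> p"
  shows "cone_summing (p / real m) p G"
proof (rule cone_summing_bounded)
  have "norm (norm (F x) ^ m) powr (p / real m) = norm (F x) powr p" for x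
    using assms(4) by (simp add: power_powr_divide)
  with assms(1) show "cone_summing (p / real m) p (\<lambda>x. norm (F x) ^ m)"
    unfolding cone_summing_def by presburger
  show "norm (G x) \<le> K * norm (norm (F x) ^ m)" if "0 \<le> x" for x
    using assms(2)[OF that] by simp
qed (use assms in auto)

lemma poly_factorization_subset_dominated:
  assumes m: "1 \<le> m" and p: "1 \<le> p"
  shows "poly_factorization m (positive_summing p :: 'x::banach set \<Rightarrow> ('e::banach_lattice \<Rightarrow> 'x) set)
    \<subseteq> (positive_dominated m p :: ('e \<Rightarrow> 'y::banach) set)"
proof
  fix P :: "'e \<Rightarrow> 'y" assume "P \<in> poly_factorization m (positive_summing p :: 'x set \<Rightarrow> ('e \<Rightarrow> 'x) set)"
  then obtain X and u :: "'e \<Rightarrow> 'x" and Q where P: "P \<in> hom_polys m UNIV" and X: "subspace X"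
    and u: "range u \<subseteq> X" "cone_summing p p u"
    and Q: "Q \<in> hom_polys m X" "P = Q \<circ> u"
    unfolding poly_factorization_def positive_summing_eq[OF p] by blast
  obtain K where K: "0 \<le> K" "\<And>z. z \<in> X \<Longrightarrow> norm (Q z) \<le> K * norm z ^ m"
    using hom_polys_bound[OF Q(1) X m] by blast
  have "cone_summing (p / real m) p P"
    using u Q(2) K m p by (intro cone_summing_power[OF u(2), of P K]) auto
  with P show "P \<in> positive_dominated m p"
    by (simp add: positive_dominated_eq[OF m p])
qed

section \<open>Ideal properties of dominated polynomials\<close>

lemma hom_polys_zero: "(\<lambda>x. 0) \<in> hom_polys m X"
  unfolding hom_polys_def multilinear_on_def
  by (intro CollectI conjI exI[of _ "\<lambda>_. 0"]) auto

lemma hom_polys_add: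
  assumes "P \<in> hom_polys m X" and "Q \<in> hom_polys m X"
  shows "(\<lambda>x. P x + Q x) \<in> hom_polys m X"
proof -
  obtain A B where A: "multilinear_on m X A" "\<And>x. x \<in> X \<Longrightarrow> P x = A (replicate m x)"
    and B: "multilinear_on m X B" "\<And>x. x \<in> X \<Longrightarrow> Q x = B (replicate m x)"
    using assms by (auto simp: hom_polys_def)
  have "multilinear_on m X (\<lambda>xs. A xs + B xs)"
    using A(1) B(1) unfolding multilinear_on_def by (simp add: scaleR_add_right add_ac)
  then show ?thesis
    using assms A(2) B(2) unfolding hom_polys_def
    by (intro CollectI conjI exI[of _ "\<lambda>xs. A xs + B xs"] continuous_on_add) auto
qed

lemma hom_polys_compose_linear:
  assumes P: "P \<in> hom_polys m UNIV" and u: "bounded_linear u" and v: "bounded_linear v"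
  shows "v \<circ> P \<circ> u \<in> hom_polys m UNIV"
proof -
  interpret u: bounded_linear u by (rule u)
  interpret v: bounded_linear v by (rule v)
  obtain A where A: "multilinear_on m UNIV A" "\<And>x. P x = A (replicate m x)"
    using P by (auto simp: hom_polys_def)
  have "multilinear_on m UNIV (\<lambda>xs. v (A (map u xs)))"
    using A(1) unfolding multilinear_on_def by (simp add: u.add u.scaleR v.add v.scaleR)
  moreover have "continuous_on UNIV (v \<circ> P \<circ> u)"
    using P linear_continuous_on[OF u] linear_continuous_on[OF v] unfolding hom_polys_def
    by (intro continuous_on_compose) (auto intro: continuous_on_subset)
  ultimately show ?thesis
    using A(2) unfolding hom_polys_def
    by (intro CollectI conjI exI[of _ "\<lambda>xs. v (A (map u xs))"]) auto
qed

lemma hom_polys_functional_power: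
  fixes \<phi> :: "'x::real_normed_vector \<Rightarrow>\<^sub>L real"
  shows "(\<lambda>x. blinfun_apply \<phi> x ^ m *\<^sub>R y) \<in> hom_polys m UNIV"
proof -
  have "multilinear_on m UNIV (\<lambda>xs. (\<Prod>x\<leftarrow>xs. blinfun_apply \<phi> x) *\<^sub>R y)"
    unfolding multilinear_on_def
    by (simp add: blinfun.add_right blinfun.scaleR_right distrib_left distrib_right scaleR_add_left mult_ac)
  then show ?thesis
    unfolding hom_polys_def
    by (intro CollectI conjI exI[of _ "\<lambda>xs. (\<Prod>x\<leftarrow>xs. blinfun_apply \<phi> x) *\<^sub>R y"])
       (auto intro!: continuous_intros)
qed

lemma positive_dominated_compose:
  fixes P :: "'e::banach_lattice \<Rightarrow> 'y::banach" and u :: "'g::banach_lattice \<Rightarrow> 'e" and v :: "'y \<Rightarrow> 'z::banach"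
  assumes m: "1 \<le> m" and p: "1 \<le> p"
    and P: "P \<in> positive_dominated m p" and u: "u \<in> positive_operators" and v: "bounded_linear v"
  shows "v \<circ> P \<circ> u \<in> positive_dominated m p"
proof -
  have r: "0 \<le> p / real m" "0 \<le> p" using p by auto
  note eq = positive_dominated_eq[OF m p]
  have "v \<circ> P \<circ> u \<in> hom_polys m UNIV"
    using P u v by (intro hom_polys_compose_linear) (auto simp: eq positive_operators_def)
  moreover have "cone_summing (p / real m) p (v \<circ> P)"
    using P r onorm[OF v] onorm_pos_le[OF v]
    by (intro cone_summing_bounded[of _ _ P "v \<circ> P" "onorm v"]) (auto simp: eq)
  then have "cone_summing (p / real m) p (v \<circ> P \<circ> u)"
    using u r by (intro cone_summing_compose_positive)
  ultimately show ?thesis by (simp add: eq)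
qed

lemma positive_dominated_ideal:
  assumes m: "1 \<le> m" and p: "1 \<le> p"
  shows "positive_right_polynomial_ideal m
           (positive_dominated m p :: ('e::banach_lattice \<Rightarrow> 'y::banach) set)
           (positive_dominated m p :: ('g::banach_lattice \<Rightarrow> 'z::banach) set)"
proof -
  let ?R = "positive_dominated m p :: ('e \<Rightarrow> 'y) set"
  have r: "0 \<le> p / real m" "0 \<le> p" using p by auto
  note eq = positive_dominated_eq[OF m p]
  have zero: "(\<lambda>x. 0) \<in> ?R"
    by (simp add: eq hom_polys_zero cone_summing_zero)
  have add: "(\<lambda>x. P x + Q x) \<in> ?R" if "P \<in> ?R" "Q \<in> ?R" for P Q
    using that r by (simp add: eq hom_polys_add cone_summing_add)
  \<comment> \<open>Scalar multiples are the ideal property for the identity on the right and a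
    homothety on the left.\<close>
  have scale: "(\<lambda>x. c *\<^sub>R P x) \<in> ?R" if "P \<in> ?R" for c P
    using positive_dominated_compose[OF m p that, of "\<lambda>x. x" "\<lambda>y. c *\<^sub>R y"]
    by (simp add: positive_operators_def bounded_linear_scaleR_right bounded_linear_ident o_def)
  have term_in: "(\<lambda>x. blinfun_apply \<phi> x ^ m *\<^sub>R y) \<in> ?R" for \<phi> y
  proof -
    have "cone_summing (p / real m) p (\<lambda>x. blinfun_apply \<phi> x ^ m *\<^sub>R y)"
      using r m
      by (intro cone_summing_power[of p "blinfun_apply \<phi>" _ "norm y"] cone_summing_functional)
         (auto simp: power_abs)
    then show ?thesis by (simp add: eq hom_polys_functional_power)
  qed
  have "(\<lambda>x. \<Sum>i<k. blinfun_apply (\<phi> i) x ^ m *\<^sub>R y i) \<in> ?R"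
    for k and \<phi> :: "nat \<Rightarrow> 'e \<Rightarrow>\<^sub>L real" and y
    by (induction k) (simp_all add: zero add term_in)
  then have "finite_type_polys m \<subseteq> ?R"
    by (auto simp: finite_type_polys_def)
  moreover have "?R \<subseteq> hom_polys m UNIV"
    by (simp add: eq)
  ultimately show ?thesis
    unfolding positive_right_polynomial_ideal_def
    using zero add scale positive_dominated_compose[OF m p] by blast
qed

section \<open>Pietsch domination\<close>

lemma powr_convex_combination:
  fixes x y :: real
  assumes "0 \<le> u" and "0 \<le> v" and "u + v = 1" and "0 \<le> x" and "0 \<le> y" and p: "1 \<le> p"
  shows "(u * x + v * y) powr p \<le> u * x powr p + v * y powr p"
proof -
  \<comment> \<open>Treats the boundary cases \<open>x = 0\<close> and \<open>y = 0\<close>, in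
    which convexity reduces to \<open>w powr p \<le> w\<close> for weights in the unit
    interval.\<close>
  have le: "(w * z) powr p \<le> w * z powr p" if "0 \<le> w" "w \<le> 1" "0 \<le> z" for w z :: real
  proof (cases "w = 0")
    case False
    then have "w powr p \<le> w powr 1" using that p by (intro powr_mono') auto
    then show ?thesis using that False by (simp add: powr_mult mult_right_mono)
  qed simp
  consider "x = 0" | "y = 0" | "0 < x" "0 < y" using assms by linarith
  then show ?thesis
  proof cases
    case 3
    have u: "u = 1 - v" using assms(3) by simp
    show ?thesis unfolding u
      using convex_onD[OF powr_convex[OF p], of v x y] 3 assms by simp
  qed (use le[of u x] le[of v y] assms in auto)
qed

text \<open>Transfers the theorem from a type of vectors to the functions bounded on a set
  \<open>S\<close>. Such a function is cut off to 0 outside \<open>S\<close> and read as a bounded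
  continuous function on the discrete copy of \<open>'a\<close>, where continuity is automatic. The
  supremum over \<open>S\<close> is the sublinear functional.\<close>

lemma mazur_orlicz_bounded_functions:
  fixes S :: "'a set" and D :: "(('a \<Rightarrow> real) \<times> real) set"
  assumes ne: "S \<noteq> {}" and zero: "(\<lambda>x. 0, 0) \<in> D"
    and add: "\<And>f a g b. (f, a) \<in> D \<Longrightarrow> (g, b) \<in> D \<Longrightarrow> (\<lambda>x. f x + g x, a + b) \<in> D"
    and scale: "\<And>t f a. 0 < t \<Longrightarrow> (f, a) \<in> D \<Longrightarrow> (\<lambda>x. t * f x, t * a) \<in> D"
    and bdd: "\<And>f a. (f, a) \<in> D \<Longrightarrow> bounded (f ` S)"
    and le: "\<And>f a. (f, a) \<in> D \<Longrightarrow> a \<le> (SUP x\<in>S. f x)"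
  obtains \<Lambda> :: "('a \<Rightarrow> real) \<Rightarrow> real"
  where "\<And>f g. bounded (f ` S) \<Longrightarrow> bounded (g ` S) \<Longrightarrow> \<Lambda> (\<lambda>x. f x + g x) = \<Lambda> f + \<Lambda> g"
    and "\<And>c f. bounded (f ` S) \<Longrightarrow> \<Lambda> (\<lambda>x. c * f x) = c * \<Lambda> f"
    and "\<And>f. bounded (f ` S) \<Longrightarrow> \<Lambda> f \<le> (SUP x\<in>S. f x)"
    and "\<And>f a. (f, a) \<in> D \<Longrightarrow> a \<le> \<Lambda> f"
proof -
  define J :: "('a \<Rightarrow> real) \<Rightarrow> 'a discrete \<Rightarrow>\<^sub>C real"
    where "J = (\<lambda>f. Bcontfun (\<lambda>d. if of_discrete d \<in> S then f (of_discrete d) else 0))"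
  have J: "apply_bcontfun (J f) d = (if of_discrete d \<in> S then f (of_discrete d) else 0)"
    if bdd: "bounded (f ` S)" for f d
  proof -
    obtain B where "\<And>x. x \<in> S \<Longrightarrow> norm (f x) \<le> B"
      using bdd by (auto simp: bounded_iff)
    then have "(\<lambda>d. if of_discrete d \<in> S then f (of_discrete d) else 0) \<in> bcontfun"
      by (intro bcontfun_normI[of _ "max B 0"])
        (auto simp: le_max_iff_disj continuous_on_open_invariant open_discrete intro: exI[of _ UNIV])
    then show ?thesis by (simp add: J_def Bcontfun_inverse)
  qed
  have J_add: "J (\<lambda>x. f x + g x) = J f + J g" if "bounded (f ` S)" "bounded (g ` S)" for f g
    using that bounded_plus_comp[OF that] by (intro bcontfun_eqI) (simp add: J)
  have J_scale: "J (\<lambda>x. c * f x) = c *\<^sub>R J f" if "bounded (f ` S)" for f c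
    using that bounded_scaleR_comp[OF that, of c] by (intro bcontfun_eqI) (simp add: J)
  define s where "s = (\<lambda>h :: 'a discrete \<Rightarrow>\<^sub>C real. SUP x\<in>S. apply_bcontfun h (discrete x))"
  have bdd_h: "bdd_above ((\<lambda>x. apply_bcontfun h (discrete x)) ` S)" for h :: "'a discrete \<Rightarrow>\<^sub>C real"
    using norm_bounded[of h] by (intro bdd_aboveI2[of _ _ "norm h"]) (auto simp: abs_le_iff)
  have s_upper: "apply_bcontfun h (discrete x) \<le> s h" if "x \<in> S" for h x
    unfolding s_def using that by (intro cSUP_upper bdd_h)
  have s_least: "s h \<le> B" if "\<And>x. x \<in> S \<Longrightarrow> apply_bcontfun h (discrete x) \<le> B" for h B
    unfolding s_def using ne that by (rule cSUP_least)
  have s: "sublinear s"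
  proof (rule sublinearI)
    show "s (g + h) \<le> s g + s h" for g h
      by (rule s_least) (simp add: add_mono s_upper)
    show "s (t *\<^sub>R h) \<le> t * s h" if "0 < t" for t h
      by (rule s_least) (use that in \<open>simp add: mult_left_mono s_upper\<close>)
    show "s 0 = 0" using ne by (simp add: s_def)
  qed
  have s_J: "s (J f) = (SUP x\<in>S. f x)" if "bounded (f ` S)" for f
    unfolding s_def using that by (intro SUP_cong) (auto simp: J discrete_inverse)
  obtain L where L: "linear L" "\<And>h. L h \<le> s h" "\<And>h a. (h, a) \<in> (\<lambda>(f, a). (J f, a)) ` D \<Longrightarrow> a \<le> L h"
  proof (rule mazur_orlicz[OF s, of "(\<lambda>(f, a). (J f, a)) ` D"])
    have "J (\<lambda>x. 0) = 0" by (intro bcontfun_eqI) (simp add: J image_constant_conv)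
    then show "(0, 0) \<in> (\<lambda>(f, a). (J f, a)) ` D"
      using zero by force
    show "(v + w, a + b) \<in> (\<lambda>(f, a). (J f, a)) ` D"
      if v: "(v, a) \<in> (\<lambda>(f, a). (J f, a)) ` D" and w: "(w, b) \<in> (\<lambda>(f, a). (J f, a)) ` D" for v w a b
    proof -
      obtain f g where f: "(f, a) \<in> D" "v = J f" and g: "(g, b) \<in> D" "w = J g" using v w by auto
      have "v + w = J (\<lambda>x. f x + g x)" using f g by (simp add: J_add bdd)
      then show ?thesis using add[OF f(1) g(1)] by (intro image_eqI) auto
    qed
    show "(t *\<^sub>R v, t * a) \<in> (\<lambda>(f, a). (J f, a)) ` D"
      if t: "0 < t" and v: "(v, a) \<in> (\<lambda>(f, a). (J f, a)) ` D" for t v a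
    proof -
      obtain f where f: "(f, a) \<in> D" "v = J f" using v by auto
      have "t *\<^sub>R v = J (\<lambda>x. t * f x)" using f by (simp add: J_scale bdd)
      then show ?thesis using scale[OF t f(1)] by (intro image_eqI) auto
    qed
    show "a \<le> s v" if "(v, a) \<in> (\<lambda>(f, a). (J f, a)) ` D" for v a
      using that le bdd by (auto simp: s_J)
  qed blast
  show ?thesis
  proof (rule that[of "\<lambda>f. L (J f)"])
    show "L (J f) \<le> (SUP x\<in>S. f x)" if "bounded (f ` S)" for f
      using L(2)[of "J f"] s_J[OF that] by simp
    show "a \<le> L (J f)" if "(f, a) \<in> D" for f a
      using that by (intro L(3)) force
  qed (simp_all add: J_add J_scale linear_add[OF L(1)] linear_scale[OF L(1)])
qed

text \<open>Order compatibility gives one inequality for nonnegative scalars; scaling back by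
  \<open>1 / c\<close> gives the other.\<close>

lemma abs_scaleR_lattice:
  fixes x :: "'e::banach_lattice"
  shows "\<bar>t *\<^sub>R x\<bar> = \<bar>t\<bar> *\<^sub>R \<bar>x\<bar>"
proof -
  have le: "\<bar>c *\<^sub>R y\<bar> \<le> c *\<^sub>R \<bar>y\<bar>" if "0 \<le> c" for c :: real and y :: 'e
  proof (rule abs_leI)
    show "c *\<^sub>R y \<le> c *\<^sub>R \<bar>y\<bar>" using that by (intro scaleR_left_mono abs_ge_self)
    have "c *\<^sub>R (- y) \<le> c *\<^sub>R \<bar>y\<bar>" using that by (intro scaleR_left_mono abs_ge_minus_self)
    then show "- (c *\<^sub>R y) \<le> c *\<^sub>R \<bar>y\<bar>" by simp
  qed
  have pos: "\<bar>c *\<^sub>R y\<bar> = c *\<^sub>R \<bar>y\<bar>" if "0 \<le> c" for c :: real and y :: 'e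
  proof (cases "c = 0")
    case False
    then have c: "0 < c" using that by simp
    have "\<bar>(1 / c) *\<^sub>R (c *\<^sub>R y)\<bar> \<le> (1 / c) *\<^sub>R \<bar>c *\<^sub>R y\<bar>" using c by (intro le) simp
    then have "c *\<^sub>R \<bar>y\<bar> \<le> c *\<^sub>R ((1 / c) *\<^sub>R \<bar>c *\<^sub>R y\<bar>)" using c by (intro scaleR_left_mono) auto
    then show ?thesis using c le[OF that, of y] by (intro antisym) auto
  qed simp
  show ?thesis
  proof (cases "0 \<le> t")
    case False
    then show ?thesis using pos[of "- t" x] by (simp add: abs_minus_cancel)
  qed (use pos in simp)
qed

lemma norm_abs_lattice: "norm \<bar>x\<bar> = norm x" for x :: "'e::banach_lattice"
  by (intro antisym norm_mono_abs) auto

text \<open>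
  A positive functional \<open>\<Lambda>\<close> on the bounded functions on the positive dual ball replaces
  integration against the Pietsch measure, so that neither weak* compactness nor measure theory
  is needed.
\<close>

lemma pietsch_domination:
  fixes P :: "'e::banach_lattice \<Rightarrow> 'y::real_normed_vector"
  assumes m: "1 \<le> m" and p: "1 \<le> p" and P: "cone_summing (p / real m) p P"
    and hom: "\<And>t x. P (t *\<^sub>R x) = t ^ m *\<^sub>R P x"
  obtains q :: "'e \<Rightarrow> real" and C
  where "\<And>x y. q (x + y) \<le> q x + q y"
    and "\<And>t x. q (t *\<^sub>R x) = \<bar>t\<bar> * q x"
    and "\<And>x. q x \<le> norm x"
    and "\<And>x y. \<bar>x\<bar> \<le> \<bar>y\<bar> \<Longrightarrow> q x \<le> q y"
    and "\<And>xs. (\<And>x. x \<in> set xs \<Longrightarrow> 0 \<le> x) \<Longrightarrow> (\<Sum>x\<leftarrow>xs. q x powr p) \<le> weak_moment p xs"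
    and "0 \<le> C" and "\<And>x. 0 \<le> x \<Longrightarrow> norm (P x) \<le> C * q x ^ m"
proof -
  let ?S = "positive_dual_ball :: ('e \<Rightarrow>\<^sub>L real) set"
  have p0: "0 < p" using p by simp
  obtain K where K: "0 < K"
      "\<And>xs. (\<And>x. x \<in> set xs \<Longrightarrow> 0 \<le> x) \<Longrightarrow> (\<Sum>x\<leftarrow>xs. norm (P x) powr (p / real m)) \<le> K * weak_moment p xs"
    using cone_summingE[OF P] p0 by (metis less_imp_le)
  \<comment> \<open>The summing hypothesis says that each second entry is at most the supremum of
    the first over the ball, which is the compatibility condition of the Mazur-Orlicz
    theorem.\<close>
  define D where "D = {(\<lambda>\<phi> :: 'e \<Rightarrow>\<^sub>L real. K * (\<Sum>x\<leftarrow>xs. \<bar>blinfun_apply \<phi> x\<bar> powr p),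
      \<Sum>x\<leftarrow>xs. norm (P x) powr (p / real m)) | xs. \<forall>x\<in>set xs. 0 \<le> x}"
  have moment_bounded: "bounded ((\<lambda>\<phi>. \<Sum>x\<leftarrow>xs. \<bar>blinfun_apply \<phi> (f x)\<bar> powr p) ` ?S)" for xs :: "'e list" and f
  proof (rule boundedI)
    fix a assume "a \<in> (\<lambda>\<phi>. \<Sum>x\<leftarrow>xs. \<bar>blinfun_apply \<phi> (f x)\<bar> powr p) ` ?S"
    then obtain \<phi> where \<phi>: "\<phi> \<in> ?S" "a = (\<Sum>x\<leftarrow>xs. \<bar>blinfun_apply \<phi> (f x)\<bar> powr p)" by blast
    have "0 \<le> a" unfolding \<phi>(2) by (rule sum_list_nonneg) auto
    moreover have "a \<le> (\<Sum>x\<leftarrow>xs. norm (f x) powr p)"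
      unfolding \<phi>(2) using p0 \<phi>(1) by (intro sum_list_mono powr_mono2 positive_dual_ball_le_norm) auto
    ultimately show "norm a \<le> (\<Sum>x\<leftarrow>xs. norm (f x) powr p)" by simp
  qed
  have D_bounded: "bounded (f ` ?S)" if "(f, a) \<in> D" for f a
    using that bounded_scaleR_comp[OF moment_bounded[of "\<lambda>x. x"], of K] by (auto simp: D_def)
  obtain \<Lambda> :: "(('e \<Rightarrow>\<^sub>L real) \<Rightarrow> real) \<Rightarrow> real" where
    \<Lambda>_add: "\<And>f g. bounded (f ` ?S) \<Longrightarrow> bounded (g ` ?S) \<Longrightarrow> \<Lambda> (\<lambda>x. f x + g x) = \<Lambda> f + \<Lambda> g"
    and \<Lambda>_scale: "\<And>c f. bounded (f ` ?S) \<Longrightarrow> \<Lambda> (\<lambda>x. c * f x) = c * \<Lambda> f"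
    and \<Lambda>_le: "\<And>f. bounded (f ` ?S) \<Longrightarrow> \<Lambda> f \<le> (SUP x\<in>?S. f x)"
    and \<Lambda>_D: "\<And>f a. (f, a) \<in> D \<Longrightarrow> a \<le> \<Lambda> f"
  proof (rule mazur_orlicz_bounded_functions[of ?S D])
    show "?S \<noteq> {}" using zero_in_positive_dual_ball by blast
    show "(\<lambda>x. 0, 0) \<in> D" by (auto simp: D_def intro!: exI[of _ "[]"])
    show "(\<lambda>x. f x + g x, a + b) \<in> D" if fa: "(f, a) \<in> D" and gb: "(g, b) \<in> D" for f a g b
    proof -
      obtain xs ys where "f = (\<lambda>\<phi>. K * (\<Sum>x\<leftarrow>xs. \<bar>blinfun_apply \<phi> x\<bar> powr p))"
          "a = (\<Sum>x\<leftarrow>xs. norm (P x) powr (p / real m))" "\<forall>x\<in>set xs. 0 \<le> x"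
          "g = (\<lambda>\<phi>. K * (\<Sum>x\<leftarrow>ys. \<bar>blinfun_apply \<phi> x\<bar> powr p))"
          "b = (\<Sum>x\<leftarrow>ys. norm (P x) powr (p / real m))" "\<forall>x\<in>set ys. 0 \<le> x"
        using fa gb by (auto simp: D_def)
      then show ?thesis
        unfolding D_def by (intro CollectI exI[of _ "xs @ ys"]) (auto simp: distrib_left)
    qed
    show "(\<lambda>x. t * f x, t * a) \<in> D" if t: "0 < t" and fa: "(f, a) \<in> D" for t f a
    proof -
      obtain xs where xs: "f = (\<lambda>\<phi>. K * (\<Sum>x\<leftarrow>xs. \<bar>blinfun_apply \<phi> x\<bar> powr p))"
          "a = (\<Sum>x\<leftarrow>xs. norm (P x) powr (p / real m))" "\<forall>x\<in>set xs. 0 \<le> x"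
        using fa by (auto simp: D_def)
      \<comment> \<open>Scaling the vectors by \<open>c\<close> multiplies the moments by
        \<open>c powr p = t\<close>. It multiplies \<open>norm (P x) powr (p / m)\<close> by the
        same factor, since \<open>P\<close> has degree \<open>m\<close>.\<close>
      define c where "c = t powr (1 / p)"
      have c: "0 < c" "c powr p = t" using t p0 by (auto simp: c_def powr_powr)
      have "t * f \<phi> = K * (\<Sum>x\<leftarrow>map ((*\<^sub>R) c) xs. \<bar>blinfun_apply \<phi> x\<bar> powr p)" for \<phi>
        using c by (simp add: xs(1) o_def blinfun.scaleR_right abs_mult powr_mult sum_list_const_mult)
      moreover have "t * a = (\<Sum>x\<leftarrow>map ((*\<^sub>R) c) xs. norm (P x) powr (p / real m))"
        using c m by (simp add: xs(2) o_def hom powr_mult sum_list_const_mult power_powr_divide)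
      moreover have "\<forall>x\<in>set (map ((*\<^sub>R) c) xs). 0 \<le> x"
        using xs(3) c by (auto intro: scaleR_nonneg_nonneg)
      ultimately show ?thesis unfolding D_def by blast
    qed
    show "a \<le> (SUP \<phi>\<in>?S. f \<phi>)" if fa: "(f, a) \<in> D" for f a
    proof -
      obtain xs where xs: "f = (\<lambda>\<phi>. K * (\<Sum>x\<leftarrow>xs. \<bar>blinfun_apply \<phi> x\<bar> powr p))"
          "a = (\<Sum>x\<leftarrow>xs. norm (P x) powr (p / real m))" "\<forall>x\<in>set xs. 0 \<le> x"
        using fa by (auto simp: D_def)
      have up: "f \<phi> \<le> (SUP \<phi>\<in>?S. f \<phi>)" if "\<phi> \<in> ?S" for \<phi>
        using that D_bounded[OF fa] by (intro cSUP_upper bounded_imp_bdd_above)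
      have "weak_moment p xs \<le> (SUP \<phi>\<in>?S. f \<phi>) / K"
        using up K(1) by (intro weak_moment_least) (simp add: xs(1) field_simps)
      then show ?thesis using K(1) K(2)[of xs] xs by (simp add: field_simps)
    qed
  qed (use D_bounded in blast)+
  have \<Lambda>_bound: "\<Lambda> f \<le> b" if "bounded (f ` ?S)" "\<And>\<phi>. \<phi> \<in> ?S \<Longrightarrow> f \<phi> \<le> b" for f b
    using \<Lambda>_le[OF that(1)] cSUP_least[of ?S f b] that(2) zero_in_positive_dual_ball by force
  \<comment> \<open>Positivity is not imposed through \<open>D\<close>: it follows from the bound by
    the supremum, applied to \<open>f - g \<le> 0\<close>.\<close>
  have \<Lambda>_mono: "\<Lambda> f \<le> \<Lambda> g" if b: "bounded (f ` ?S)" "bounded (g ` ?S)" and le: "\<And>\<phi>. \<phi> \<in> ?S \<Longrightarrow> f \<phi> \<le> g \<phi>" for f g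
  proof -
    have b': "bounded ((\<lambda>\<phi>. (- 1) * g \<phi>) ` ?S)" using bounded_scaleR_comp[OF b(2), of "- 1"] by simp
    have "\<Lambda> (\<lambda>\<phi>. f \<phi> + (- 1) * g \<phi>) \<le> 0"
      using bounded_plus_comp[OF b(1) b'] le by (intro \<Lambda>_bound) auto
    then show ?thesis using \<Lambda>_add[OF b(1) b'] \<Lambda>_scale[OF b(2), of "- 1"] by simp
  qed
  define w where "w = (\<lambda>(x :: 'e) \<phi>. \<bar>blinfun_apply \<phi> \<bar>x\<bar>\<bar> powr p)"
  have w_bounded: "bounded (w x ` ?S)" for x
    using moment_bounded[of abs "[x]"] by (simp add: w_def)
  define q where "q = (\<lambda>x. \<Lambda> (w x) powr (1 / p))"
  have \<Lambda>_w: "0 \<le> \<Lambda> (w x)" for x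
  proof -
    have "\<Lambda> (\<lambda>\<phi>. 0 * w x \<phi>) \<le> \<Lambda> (w x)"
      by (rule \<Lambda>_mono) (use w_bounded in \<open>auto simp: w_def image_constant_conv\<close>)
    then show ?thesis using \<Lambda>_scale[OF w_bounded, of 0 x] by simp
  qed
  have q_powr: "q x powr p = \<Lambda> (w x)" for x
    using \<Lambda>_w p0 by (simp add: q_def powr_powr)
  have q_nonneg: "0 \<le> q x" for x by (simp add: q_def)
  have q_leI: "q x \<le> a" if "\<Lambda> (w x) \<le> a powr p" "0 \<le> a" for x a
  proof -
    have "q x \<le> (a powr p) powr (1 / p)"
      unfolding q_def using that \<Lambda>_w p0 by (intro powr_mono2) auto
    then show ?thesis using that p0 by (simp add: powr_powr)
  qed
  have q_mono: "q x \<le> q y" if "\<bar>x\<bar> \<le> \<bar>y\<bar>" for x y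
  proof -
    have "\<Lambda> (w x) \<le> \<Lambda> (w y)"
      using that p0
      by (intro \<Lambda>_mono w_bounded)
        (auto simp: w_def positive_dual_ball_nonneg intro!: powr_mono2 positive_dual_ball_mono)
    then show ?thesis using \<Lambda>_w p0 unfolding q_def by (intro powr_mono2) auto
  qed
  have q_norm: "q x \<le> norm x" for x
  proof (rule q_leI)
    show "\<Lambda> (w x) \<le> norm x powr p"
      using p0 positive_dual_ball_le_norm[of _ "\<bar>x\<bar>"]
      by (intro \<Lambda>_bound w_bounded) (auto simp: w_def norm_abs_lattice intro!: powr_mono2)
  qed simp
  have q_scale: "q (t *\<^sub>R x) = \<bar>t\<bar> * q x" for t x
  proof -
    have "w (t *\<^sub>R x) = (\<lambda>\<phi>. \<bar>t\<bar> powr p * w x \<phi>)"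
      by (auto simp: w_def abs_scaleR_lattice blinfun.scaleR_right abs_mult powr_mult)
    then have "\<Lambda> (w (t *\<^sub>R x)) = \<bar>t\<bar> powr p * \<Lambda> (w x)"
      using \<Lambda>_scale[OF w_bounded] by simp
    then show ?thesis using \<Lambda>_w[of x] p0 by (simp add: q_def powr_mult powr_powr)
  qed
  have q_add: "q (x + y) \<le> q x + q y" for x y
  proof (rule field_le_epsilon)
    fix e :: real assume e: "0 < e"
    \<comment> \<open>Minkowski's inequality for \<open>\<Lambda>\<close>. The number
      \<open>e / 2\<close> makes \<open>a\<close> and \<open>b\<close> positive even where
      \<open>q\<close> vanishes. Write \<open>f + g\<close> as \<open>a + b\<close> times the convex
      combination of \<open>f / a\<close> and \<open>g / b\<close> with weights
      \<open>a / (a + b)\<close> and \<open>b / (a + b)\<close>; then \<open>u\<close> and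
      \<open>v\<close> are the resulting coefficients, chosen so that
      \<open>u * a powr p + v * b powr p = (a + b) powr p\<close>.\<close>
    define a where "a = q x + e / 2"
    define b where "b = q y + e / 2"
    have ab: "0 < a" "0 < b" "q x \<le> a" "q y \<le> b"
      using e q_nonneg[of x] q_nonneg[of y] by (auto simp: a_def b_def)
    define u where "u = (a + b) powr p * (a / (a + b)) / a powr p"
    define v where "v = (a + b) powr p * (b / (a + b)) / b powr p"
    have uv: "0 \<le> u" "0 \<le> v" using ab by (auto simp: u_def v_def)
    have bnd: "bounded ((\<lambda>\<phi>. u * w x \<phi>) ` ?S)" "bounded ((\<lambda>\<phi>. v * w y \<phi>) ` ?S)"
      using bounded_scaleR_comp[OF w_bounded] by auto
    have "w (x + y) \<phi> \<le> u * w x \<phi> + v * w y \<phi>" if \<phi>: "\<phi> \<in> ?S" for \<phi>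
    proof -
      let ?f = "blinfun_apply \<phi> \<bar>x\<bar>" and ?g = "blinfun_apply \<phi> \<bar>y\<bar>"
      have fg: "0 \<le> ?f" "0 \<le> ?g" using \<phi> by (auto intro: positive_dual_ball_nonneg)
      have "blinfun_apply \<phi> \<bar>x + y\<bar> \<le> blinfun_apply \<phi> (\<bar>x\<bar> + \<bar>y\<bar>)"
        using \<phi> by (intro positive_dual_ball_mono abs_triangle_ineq)
      then have "w (x + y) \<phi> \<le> (?f + ?g) powr p"
        using p0 \<phi> by (auto simp: w_def blinfun.add_right positive_dual_ball_nonneg intro!: powr_mono2)
      also have "?f + ?g = (a + b) * (a / (a + b) * (?f / a) + b / (a + b) * (?g / b))"
        using ab by (simp add: distrib_left)
      also have "\<dots> powr p = (a + b) powr p * (a / (a + b) * (?f / a) + b / (a + b) * (?g / b)) powr p"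
        by (rule powr_mult)
      also have "\<dots> \<le> (a + b) powr p * (a / (a + b) * (?f / a) powr p + b / (a + b) * (?g / b) powr p)"
        using ab fg p
        by (intro mult_left_mono powr_convex_combination) (auto simp: add_divide_distrib[symmetric])
      also have "\<dots> = u * w x \<phi> + v * w y \<phi>"
        using ab fg by (simp add: u_def v_def w_def powr_divide distrib_left)
      finally show ?thesis .
    qed
    then have "\<Lambda> (w (x + y)) \<le> \<Lambda> (\<lambda>\<phi>. u * w x \<phi> + v * w y \<phi>)"
      using bnd by (intro \<Lambda>_mono w_bounded bounded_plus_comp)
    also have "\<dots> = u * q x powr p + v * q y powr p"
      using bnd by (simp add: \<Lambda>_add \<Lambda>_scale w_bounded q_powr)
    also have "\<dots> \<le> u * a powr p + v * b powr p"
      using ab uv p0 q_nonneg by (intro add_mono mult_left_mono powr_mono2) auto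
    also have "\<dots> = (a + b) powr p * (a / (a + b) + b / (a + b))"
      using ab by (simp add: u_def v_def distrib_left)
    also have "a / (a + b) + b / (a + b) = 1"
      using ab by (simp add: add_divide_distrib[symmetric])
    finally have "q (x + y) \<le> a + b" using ab by (intro q_leI) auto
    then show "q (x + y) \<le> q x + q y + e" by (simp add: a_def b_def)
  qed
  \<comment> \<open>Boundedness is carried through the induction because \<open>\<Lambda>\<close> is
    known to be additive only on bounded functions.\<close>
  have q_sum: "(\<Sum>x\<leftarrow>xs. q x powr p) = \<Lambda> (\<lambda>\<phi>. \<Sum>x\<leftarrow>xs. w x \<phi>) \<and> bounded ((\<lambda>\<phi>. \<Sum>x\<leftarrow>xs. w x \<phi>) ` ?S)" for xs
  proof (induction xs)
    case Nil
    have "\<Lambda> (\<lambda>\<phi>. 0) = 0" using \<Lambda>_scale[OF w_bounded, of 0 0] by simp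
    then show ?case by (simp add: image_constant_conv)
  next
    case (Cons x xs)
    then show ?case
      using \<Lambda>_add[OF w_bounded[of x], of "\<lambda>\<phi>. \<Sum>x\<leftarrow>xs. w x \<phi>"] bounded_plus_comp[OF w_bounded[of x]]
      by (simp add: q_powr)
  qed
  have q_summing: "(\<Sum>x\<leftarrow>xs. q x powr p) \<le> weak_moment p xs" if "\<And>x. x \<in> set xs \<Longrightarrow> 0 \<le> x" for xs
  proof -
    have "(\<Sum>x\<leftarrow>xs. w x \<phi>) = (\<Sum>x\<leftarrow>xs. \<bar>blinfun_apply \<phi> x\<bar> powr p)" for \<phi>
      using that by (intro arg_cong[where f = sum_list] map_cong) (auto simp: w_def)
    then show ?thesis
      using q_sum[of xs] p0 weak_moment_upper[of p _ xs] by (auto intro: \<Lambda>_bound)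
  qed
  have q_dom: "norm (P x) \<le> K powr (real m / p) * q x ^ m" if x: "0 \<le> x" for x
  proof -
    \<comment> \<open>One-element lists suffice here; longer ones only served to make
      \<open>D\<close> a cone.\<close>
    have "(\<lambda>\<phi>. K * w x \<phi>, norm (P x) powr (p / real m)) \<in> D"
      using x unfolding D_def by (intro CollectI exI[of _ "[x]"]) (auto simp: w_def)
    then have "norm (P x) powr (p / real m) \<le> K * q x powr p"
      using \<Lambda>_D \<Lambda>_scale[OF w_bounded] q_powr by metis
    then have "(norm (P x) powr (p / real m)) powr (real m / p) \<le> (K * q x powr p) powr (real m / p)"
      using m p0 by (intro powr_mono2) auto
    then have "norm (P x) \<le> K powr (real m / p) * q x powr real m"
      using m p0 K(1) q_nonneg by (simp add: powr_powr powr_mult)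
    also have "q x powr real m = q x ^ m"
      using m q_nonneg[of x] by (cases "q x = 0") (auto simp: powr_realpow power_0_left)
    finally show ?thesis .
  qed
  show ?thesis
    by (rule that[of q "K powr (real m / p)"]) (use q_add q_scale q_norm q_mono q_summing q_dom in auto)
qed

section \<open>Polarization\<close>

text \<open>\<open>fact m\<close> times the symmetrization of \<open>A\<close>. The factor is
  divided out only when the factorization is assembled.\<close>

definition polarization :: "nat \<Rightarrow> ('x list \<Rightarrow> 'y::real_vector) \<Rightarrow> 'x list \<Rightarrow> 'y"
  where "polarization m A xs = (\<Sum>js\<in>permutations_of_set {..<m}. A (map (nth xs) js))"

lemma length_permutation_lessThan: "js \<in> permutations_of_set {..<m} \<Longrightarrow> length js = m"
  using length_finite_permutations_of_set[of js "{..<m}"] by simp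

text \<open>A permutation lists each index exactly once, so the argument in a given slot occurs once
  in the permuted list, and linearity of \<open>A\<close> in that position applies.\<close>

lemma multilinear_on_polarization:
  fixes A :: "'x::real_vector list \<Rightarrow> 'y::real_vector"
  assumes A: "multilinear_on m UNIV A"
  shows "multilinear_on m UNIV (polarization m A)"
proof -
  have split: "\<exists>us vs. length us + length vs + 1 = m \<and> (\<forall>a. map (nth (xs @ a # ys)) js = us @ a # vs)"
    if len: "length xs + length ys + 1 = m" and js: "js \<in> permutations_of_set {..<m}" for js xs and ys :: "'x list"
  proof -
    have "length xs \<in> set js" using len unfolding permutations_of_setD(1)[OF js] by simp
    then obtain hs ks where ik: "js = hs @ length xs # ks" using split_list by metis
    have "distinct js" using js by (rule permutations_of_setD)
    then have ne: "length xs \<notin> set hs" "length xs \<notin> set ks" by (auto simp: ik)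
    \<comment> \<open>The entry 0 is a placeholder: off the slot, the arguments do not depend on
      \<open>a\<close>.\<close>
    have nth: "(xs @ a # ys) ! i = (xs @ 0 # ys) ! i" if "i \<noteq> length xs" for i a
      using that by (cases "i < length xs") (auto simp: nth_append nth_Cons split: nat.split)
    have map: "map (nth (xs @ a # ys)) js = map (nth (xs @ 0 # ys)) hs @ a # map (nth (xs @ 0 # ys)) ks" for a
    proof -
      have "map (nth (xs @ a # ys)) hs = map (nth (xs @ 0 # ys)) hs"
        by (rule map_cong[OF refl], rule nth) (use ne in blast)
      moreover have "map (nth (xs @ a # ys)) ks = map (nth (xs @ 0 # ys)) ks"
        by (rule map_cong[OF refl], rule nth) (use ne in blast)
      ultimately show ?thesis by (simp add: ik)
    qed
    have "length hs + length ks + 1 = m" using length_permutation_lessThan[OF js] by (simp add: ik)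
    then show ?thesis
      using map by (intro exI[of _ "map (nth (xs @ 0 # ys)) hs"] exI[of _ "map (nth (xs @ 0 # ys)) ks"] conjI allI) simp_all
  qed
  have "A (map (nth (xs @ (a + b) # ys)) js) = A (map (nth (xs @ a # ys)) js) + A (map (nth (xs @ b # ys)) js)"
      and "A (map (nth (xs @ (c *\<^sub>R a) # ys)) js) = c *\<^sub>R A (map (nth (xs @ a # ys)) js)"
    if len: "length xs + length ys + 1 = m" and js: "js \<in> permutations_of_set {..<m}" for xs ys js a b c
  proof -
    obtain us vs where us: "length us + length vs + 1 = m" "\<And>a. map (nth (xs @ a # ys)) js = us @ a # vs"
      using split[OF len js] by blast
    show "A (map (nth (xs @ (a + b) # ys)) js) = A (map (nth (xs @ a # ys)) js) + A (map (nth (xs @ b # ys)) js)"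
      unfolding us(2) using us(1) by (intro multilinear_on_add[OF A]) auto
    show "A (map (nth (xs @ (c *\<^sub>R a) # ys)) js) = c *\<^sub>R A (map (nth (xs @ a # ys)) js)"
      unfolding us(2) using us(1) by (intro multilinear_on_scaleR[OF A]) auto
  qed
  note slot = this
  show ?thesis
    unfolding multilinear_on_def polarization_def
    by (intro allI impI conjI ballI; simp only: sum.distrib[symmetric] scaleR_sum_right; intro sum.cong refl slot)
qed

lemma polarization_replicate:
  fixes A :: "'x list \<Rightarrow> 'y::real_vector"
  shows "polarization m A (replicate m x) = fact m *\<^sub>R A (replicate m x)"
proof -
  have "map (nth (replicate m x)) js = replicate m x" if js: "js \<in> permutations_of_set {..<m}" for js
    using length_permutation_lessThan[OF js] permutations_of_setD(1)[OF js]
    by (intro replicate_eqI) auto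
  then have "polarization m A (replicate m x) = (\<Sum>js\<in>permutations_of_set {..<m}. A (replicate m x))"
    unfolding polarization_def by (intro sum.cong) auto
  then show ?thesis
    by (simp add: sum_constant_scaleR)
qed

lemma multilinear_on_sum:
  assumes A: "multilinear_on m UNIV A" and "length xs + length ys + 1 = m" and "finite S"
  shows "A (xs @ (\<Sum>j\<in>S. f j) # ys) = (\<Sum>j\<in>S. A (xs @ f j # ys))"
  using \<open>finite S\<close>
proof (induction S)
  case empty
  show ?case using multilinear_on_scaleR[OF A assms(2), of 0 0] by simp
next
  case (insert j S)
  then show ?case using multilinear_on_add[OF A assms(2)] by simp
qed

text \<open>The prefix \<open>zs\<close> holds arguments already expanded, which makes induction on
  the remaining ones possible.\<close>

lemma multilinear_on_replicate_sum:
  assumes A: "multilinear_on m UNIV A" and S: "finite S" and "length zs + n = m"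
  shows "A (zs @ replicate n (\<Sum>j\<in>S. f j)) = (\<Sum>js\<in>{js. set js \<subseteq> S \<and> length js = n}. A (zs @ map f js))"
  using assms(3)
proof (induction n arbitrary: zs)
  case 0
  have "{js. set js \<subseteq> S \<and> length js = 0} = {[]}" by auto
  then show ?case by simp
next
  case (Suc n)
  let ?L = "{js. set js \<subseteq> S \<and> length js = n}"
  have "A (zs @ replicate (Suc n) (sum f S)) = (\<Sum>j\<in>S. A ((zs @ [f j]) @ replicate n (sum f S)))"
    using multilinear_on_sum[OF A _ S, of zs "replicate n (sum f S)" f] Suc.prems by simp
  also have "\<dots> = (\<Sum>j\<in>S. \<Sum>js\<in>?L. A ((zs @ [f j]) @ map f js))"
    using Suc.prems by (intro sum.cong Suc.IH) auto
  also have "\<dots> = (\<Sum>js\<in>?L. \<Sum>j\<in>S. A (zs @ map f (j # js)))"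
    by (subst sum.swap) simp
  also have "\<dots> = (\<Sum>(js, j)\<in>?L \<times> S. A (zs @ map f (j # js)))"
    by (rule sum.cartesian_product)
  also have "\<dots> = (\<Sum>js\<in>{js. set js \<subseteq> S \<and> length js = Suc n}. A (zs @ map f js))"
    unfolding lists_length_Suc_eq by (subst sum.reindex) (auto simp: inj_on_def split_def)
  finally show ?case .
qed

text \<open>Between a proper subset \<open>T\<close> and \<open>U\<close>, there are as many sets of
  even as of odd cardinality.\<close>

lemma sum_alternating_supersets:
  assumes "finite U" and "T \<subseteq> U"
  shows "(\<Sum>S | S \<in> Pow U \<and> T \<subseteq> S. (- 1) ^ (card U - card S)) = (if T = U then 1 else 0 :: real)"
proof -
  let ?I = "{S. S \<in> Pow U \<and> T \<subseteq> S}"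
  have "(- 1) ^ (card U - card S) = (- 1) ^ card U * (- 1 :: real) ^ card S" if "S \<in> ?I" for S
  proof -
    have "card S \<le> card U" using that assms(1) by (auto intro: card_mono)
    then obtain k where "card U = card S + k" using le_Suc_ex by blast
    then show ?thesis by (simp add: power_add mult.assoc flip: power_mult_distrib)
  qed
  then have eq: "(\<Sum>S\<in>?I. (- 1) ^ (card U - card S)) = (- 1) ^ card U * (\<Sum>S\<in>?I. (- 1 :: real) ^ card S)"
    by (simp add: sum_distrib_left)
  show ?thesis
  proof (cases "T = U")
    case True
    then have "?I = {U}" by auto
    then show ?thesis using True by simp
  next
    case False
    with assms(2) have "T \<subset> U" by auto
    then have "(\<Sum>S\<in>?I. (- 1 :: real) ^ card S) = 0"
      using card_subsupersets_even_odd[OF assms(1), of T] assms(1)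
      by (intro sum_alternating_cancels) (auto simp: conj_ac)
    then show ?thesis using eq False by simp
  qed
qed

text \<open>Expand each diagonal value over index lists and exchange the sums. The coefficient of a
  list is the alternating sum over the supersets of its entries, which vanishes unless all indices
  occur; a list of length \<open>m\<close> containing all \<open>m\<close> indices is a permutation.
  Unlike the version with signs on the vectors, this one evaluates \<open>A\<close> only at subset
  sums and so stays in the cone.\<close>

lemma polarization_formula:
  assumes A: "multilinear_on m UNIV A" and xs: "length xs = m"
  shows "polarization m A xs =
    (\<Sum>S\<in>Pow {..<m}. (- 1) ^ (m - card S) *\<^sub>R A (replicate m (\<Sum>j\<in>S. xs ! j)))"
proof -
  let ?U = "{..<m}"
  let ?L = "{js. set js \<subseteq> ?U \<and> length js = m}"
  let ?g = "\<lambda>S js. (- 1) ^ (m - card S) *\<^sub>R A (map (nth xs) js)"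
  have fin: "finite ?L" by (rule finite_lists_length_eq) simp
  have "A (replicate m (\<Sum>j\<in>S. xs ! j)) = (\<Sum>js | js \<in> ?L \<and> set js \<subseteq> S. A (map (nth xs) js))"
    if "S \<in> Pow ?U" for S
  proof -
    have "{js. set js \<subseteq> S \<and> length js = m} = {js. js \<in> ?L \<and> set js \<subseteq> S}" using that by auto
    moreover have "finite S" using that finite_subset by auto
    ultimately show ?thesis using multilinear_on_replicate_sum[OF A, of S "[]" m "nth xs"] by simp
  qed
  then have "(\<Sum>S\<in>Pow ?U. (- 1) ^ (m - card S) *\<^sub>R A (replicate m (\<Sum>j\<in>S. xs ! j)))
      = (\<Sum>S\<in>Pow ?U. \<Sum>js | js \<in> ?L \<and> set js \<subseteq> S. ?g S js)"
    by (simp add: scaleR_sum_right)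
  also have "\<dots> = (\<Sum>js\<in>?L. \<Sum>S | S \<in> Pow ?U \<and> set js \<subseteq> S. ?g S js)"
    using fin by (intro sum.swap_restrict) auto
  also have "\<dots> = (\<Sum>js\<in>?L. (if set js = ?U then 1 else 0) *\<^sub>R A (map (nth xs) js))"
  proof (rule sum.cong)
    fix js assume js: "js \<in> ?L"
    have "(\<Sum>S | S \<in> Pow ?U \<and> set js \<subseteq> S. ?g S js)
        = (\<Sum>S | S \<in> Pow ?U \<and> set js \<subseteq> S. (- 1) ^ (card ?U - card S)) *\<^sub>R A (map (nth xs) js)"
      by (simp add: scaleR_sum_left)
    then show "(\<Sum>S | S \<in> Pow ?U \<and> set js \<subseteq> S. ?g S js) = (if set js = ?U then 1 else 0) *\<^sub>R A (map (nth xs) js)"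
      using sum_alternating_supersets[of ?U "set js"] js by simp
  qed simp
  also have "\<dots> = (\<Sum>js | js \<in> ?L \<and> set js = ?U. A (map (nth xs) js))"
    using fin by (subst sum.inter_filter) (auto intro: sum.cong)
  also have "{js. js \<in> ?L \<and> set js = ?U} = permutations_of_set ?U"
  proof (intro set_eqI iffI)
    fix js assume "js \<in> {js. js \<in> ?L \<and> set js = ?U}"
    then have js: "set js = ?U" "length js = m" by auto
    then have "distinct js" by (intro card_distinct) simp
    with js(1) show "js \<in> permutations_of_set ?U" by (rule permutations_of_setI)
  next
    fix js assume js: "js \<in> permutations_of_set ?U"
    show "js \<in> {js. js \<in> ?L \<and> set js = ?U}"
      using permutations_of_setD(1)[OF js] length_permutation_lessThan[OF js] by simp
  qed
  finally show ?thesis by (simp add: polarization_def)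
qed

text \<open>Writing an argument as the difference of \<open>pprt x\<close> and
  \<open>- nprt x\<close> costs a factor 2 per slot. Both parts have modulus at most that of
  \<open>x\<close>, so \<open>mono\<close> keeps them within \<open>R\<close>. In the induction
  \<open>vs\<close> is the suffix already in the cone.\<close>

lemma multilinear_on_bound_from_cone:
  fixes B :: "'e::banach_lattice list \<Rightarrow> 'y::real_normed_vector" and q :: "'e \<Rightarrow> real"
  assumes B: "multilinear_on m UNIV B"
    and pos: "\<And>xs. length xs = m \<Longrightarrow> (\<And>x. x \<in> set xs \<Longrightarrow> 0 \<le> x \<and> q x \<le> R) \<Longrightarrow> norm (B xs) \<le> K"
    and mono: "\<And>x y. \<bar>x\<bar> \<le> \<bar>y\<bar> \<Longrightarrow> q x \<le> q y"
    and xs: "length xs = m" "\<And>x. x \<in> set xs \<Longrightarrow> q x \<le> R"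
  shows "norm (B xs) \<le> 2 ^ m * K"
proof -
  have "norm (B (us @ vs)) \<le> 2 ^ length us * K"
    if "length us + length vs = m" "\<And>x. x \<in> set us \<Longrightarrow> q x \<le> R" "\<And>x. x \<in> set vs \<Longrightarrow> 0 \<le> x \<and> q x \<le> R" for us vs
    using that
  proof (induction us arbitrary: vs rule: rev_induct)
    case Nil
    then show ?case using pos[of vs] by simp
  next
    case (snoc x us)
    have q_le: "q (pprt x) \<le> R" "q (- nprt x) \<le> R"
      using mono[of "pprt x" x] mono[of "- nprt x" x] snoc.prems(2)[of x] by (auto simp: abs_prts)
    have "B (us @ x # vs) = B (us @ (pprt x - (- nprt x)) # vs)"
      using prts[of x] by simp
    also have "\<dots> = B (us @ pprt x # vs) - B (us @ (- nprt x) # vs)"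
      using snoc.prems(1) by (intro multilinear_on_diff[OF B]) auto
    finally have "norm (B (us @ x # vs)) \<le> norm (B (us @ pprt x # vs)) + norm (B (us @ (- nprt x) # vs))"
      by (simp add: norm_triangle_ineq4)
    also have "\<dots> \<le> 2 ^ length us * K + 2 ^ length us * K"
      using snoc.prems q_le by (intro add_mono snoc.IH) auto
    finally show ?case by (simp add: mult_ac)
  qed
  from this[of xs "[]"] xs show ?thesis by simp
qed

text \<open>The outer \<open>2 ^ m\<close> comes from splitting the arguments, the inner one counts
  the subsets in the polarization formula, and \<open>real m ^ m\<close> arises because
  \<open>q\<close> of a subset sum is at most \<open>m * R\<close>.\<close>

lemma polarization_bound:
  fixes P :: "'e::banach_lattice \<Rightarrow> 'y::real_normed_vector"
  assumes A: "multilinear_on m UNIV A" and P: "\<And>x. P x = A (replicate m x)"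
    and C: "0 \<le> C" "\<And>x. 0 \<le> x \<Longrightarrow> norm (P x) \<le> C * q x ^ m"
    and q_add: "\<And>x y. q (x + y) \<le> q x + q y" and q_zero: "q 0 = 0"
    and q_mono: "\<And>x y. \<bar>x\<bar> \<le> \<bar>y\<bar> \<Longrightarrow> q x \<le> q y"
    and R: "0 \<le> R" and xs: "length xs = m" "\<And>x. x \<in> set xs \<Longrightarrow> q x \<le> R"
  shows "norm (polarization m A xs) \<le> (2 ^ m * (2 ^ m * C * real m ^ m)) * R ^ m"
proof -
  have q_nonneg: "0 \<le> q x" for x using q_mono[of 0 x] q_zero by simp
  have "norm (polarization m A xs) \<le> 2 ^ m * (2 ^ m * (C * (real m * R) ^ m))"
  proof (rule multilinear_on_bound_from_cone[OF multilinear_on_polarization[OF A] _ q_mono xs])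
    fix ys :: "'e list" assume ys: "length ys = m" "\<And>y. y \<in> set ys \<Longrightarrow> 0 \<le> y \<and> q y \<le> R"
    have summand: "norm ((- 1) ^ (m - card S) *\<^sub>R A (replicate m (\<Sum>j\<in>S. ys ! j))) \<le> C * (real m * R) ^ m"
      if S: "S \<in> Pow {..<m}" for S
    proof -
      have fin: "finite S" using S finite_subset by auto
      have "q (\<Sum>j\<in>S. ys ! j) \<le> (\<Sum>j\<in>S. q (ys ! j))"
        using fin by induction (auto simp: q_zero intro: order_trans[OF q_add])
      also have "\<dots> \<le> (\<Sum>j\<in>S. R)" using S ys by (intro sum_mono) auto
      also have "\<dots> = real (card S) * R" by simp
      also have "\<dots> \<le> real m * R"
        using S R card_mono[of "{..<m}" S] by (intro mult_right_mono) auto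
      finally have le: "q (\<Sum>j\<in>S. ys ! j) \<le> real m * R" .
      have "norm (P (\<Sum>j\<in>S. ys ! j)) \<le> C * q (\<Sum>j\<in>S. ys ! j) ^ m"
        using S ys by (intro C sum_nonneg) auto
      also have "\<dots> \<le> C * (real m * R) ^ m"
        using C(1) le q_nonneg by (intro mult_left_mono power_mono) auto
      finally show ?thesis by (simp add: P)
    qed
    have "norm (polarization m A ys) \<le> (\<Sum>S\<in>Pow {..<m}. C * (real m * R) ^ m)"
      unfolding polarization_formula[OF A ys(1)] using summand by (rule sum_norm_le)
    then show "norm (polarization m A ys) \<le> 2 ^ m * (C * (real m * R) ^ m)"
      by (simp add: card_Pow)
  qed
  then show ?thesis by (simp add: power_mult_distrib mult_ac)
qed

section \<open>Extension of polynomials along an operator\<close>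

text \<open>The coordinates of the embedding are Hahn--Banach functionals, one norming each element of \<open>'e\<close>.\<close>

lemma seminorm_embedding:
  fixes q :: "'e::real_vector \<Rightarrow> real"
  assumes q_add: "\<And>x y. q (x + y) \<le> q x + q y" and q_scale: "\<And>t x. q (t *\<^sub>R x) = \<bar>t\<bar> * q x"
  obtains u :: "'e \<Rightarrow> 'e linfty" where "linear u" and "\<And>x. norm (u x) = q x"
proof -
  have sub: "sublinear q"
    unfolding sublinear_def using q_add q_scale by simp
  have q_minus: "q (- x) = q x" for x using q_scale[of "- 1" x] by simp
  \<comment> \<open>The Mazur-Orlicz theorem for the ray through \<open>y\<close>; the functional
    attains \<open>q\<close> at \<open>y\<close>.\<close>
  have "\<exists>L. linear L \<and> (\<forall>x. L x \<le> q x) \<and> q y \<le> L y" for y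
  proof -
    obtain L where L: "linear L" "\<And>x. L x \<le> q x" "\<And>v a. (v, a) \<in> {(t *\<^sub>R y, t * q y) | t. 0 \<le> t} \<Longrightarrow> a \<le> L v"
    proof (rule mazur_orlicz[OF sub, of "{(t *\<^sub>R y, t * q y) | t. 0 \<le> t}"])
      show "(v + w, a + b) \<in> {(t *\<^sub>R y, t * q y) | t. 0 \<le> t}"
        if v: "(v, a) \<in> {(t *\<^sub>R y, t * q y) | t. 0 \<le> t}" and w: "(w, b) \<in> {(t *\<^sub>R y, t * q y) | t. 0 \<le> t}" for v a w b
      proof -
        obtain t r where "0 \<le> t" "v = t *\<^sub>R y" "a = t * q y" "0 \<le> r" "w = r *\<^sub>R y" "b = r * q y"
          using v w by auto
        then show ?thesis by (intro CollectI exI[of _ "t + r"]) (simp add: algebra_simps)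
      qed
      show "(c *\<^sub>R v, c * a) \<in> {(t *\<^sub>R y, t * q y) | t. 0 \<le> t}"
        if c: "0 < c" and v: "(v, a) \<in> {(t *\<^sub>R y, t * q y) | t. 0 \<le> t}" for c v a
      proof -
        obtain t where "0 \<le> t" "v = t *\<^sub>R y" "a = t * q y" using v by auto
        then show ?thesis using c by (intro CollectI exI[of _ "c * t"]) simp
      qed
      show "a \<le> q v" if "(v, a) \<in> {(t *\<^sub>R y, t * q y) | t. 0 \<le> t}" for v a
        using that q_scale by auto
      show "(0, 0) \<in> {(t *\<^sub>R y, t * q y) | t. 0 \<le> t}"
        by (intro CollectI exI[of _ 0]) simp
    qed blast
    have "(1 *\<^sub>R y, 1 * q y) \<in> {(t *\<^sub>R y, t * q y) | t. 0 \<le> t}"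
      using zero_le_one by blast
    from L(3)[OF this] have "q y \<le> L y" by simp
    with L(1,2) show ?thesis by blast
  qed
  then obtain \<psi> where \<psi>: "\<And>y. linear (\<psi> y)" "\<And>y x. \<psi> y x \<le> q x" "\<And>y. q y \<le> \<psi> y y"
    by metis
  have abs: "\<bar>\<psi> y x\<bar> \<le> q x" for x y
    using \<psi>(2)[of y x] \<psi>(2)[of y "- x"] linear_neg[OF \<psi>(1), of y x] by (simp add: q_minus)
  define u :: "'e \<Rightarrow> 'e linfty" where "u = (\<lambda>x. Bcontfun (\<lambda>d. \<psi> (of_discrete d) x))"
  have u: "apply_bcontfun (u x) d = \<psi> (of_discrete d) x" for x d
  proof -
    have "(\<lambda>d. \<psi> (of_discrete d) x) \<in> bcontfun"
      by (rule bcontfun_normI[of _ "q x"])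
        (auto simp: abs continuous_on_open_invariant open_discrete intro: exI[of _ UNIV])
    then show ?thesis by (simp add: u_def Bcontfun_inverse)
  qed
  show ?thesis
  proof (rule that[of u])
    show "linear u"
      by (rule linearI; rule bcontfun_eqI) (simp_all add: u linear_add[OF \<psi>(1)] linear_scale[OF \<psi>(1)])
    show "norm (u x) = q x" for x
    proof (rule antisym)
      show "norm (u x) \<le> q x" by (rule norm_bound) (simp add: u abs)
      show "q x \<le> norm (u x)"
        using norm_bounded[of "u x" "discrete x"] \<psi>(3)[of x] by (simp add: u discrete_inverse)
    qed
  qed
qed

text \<open>Telescoping: one argument is exchanged at a time, and \<open>zs\<close> collects those
  already exchanged. The bound is available only on the ball of radius \<open>R\<close>, so the
  difference \<open>x - y\<close> is first stretched by \<open>R / \<delta>\<close>.\<close>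

lemma multilinear_on_lipschitz:
  fixes B :: "'e::real_vector list \<Rightarrow> 'y::real_normed_vector" and u :: "'e \<Rightarrow> 'z::real_normed_vector"
  assumes B: "multilinear_on m UNIV B" and u: "linear u" and R: "0 < R" and \<delta>: "0 < \<delta>"
    and bound: "\<And>xs. length xs = m \<Longrightarrow> (\<And>x. x \<in> set xs \<Longrightarrow> norm (u x) \<le> R) \<Longrightarrow> norm (B xs) \<le> K"
    and close: "list_all2 (\<lambda>x y. norm (u x - u y) \<le> \<delta>) xs ys"
    and len: "length zs + length xs = m"
    and le: "\<And>x. x \<in> set zs \<union> set xs \<union> set ys \<Longrightarrow> norm (u x) \<le> R"
  shows "norm (B (zs @ xs) - B (zs @ ys)) \<le> real (length xs) * (\<delta> / R * K)"
  using close len le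
proof (induction xs ys arbitrary: zs rule: list_all2_induct)
  case Nil
  then show ?case by simp
next
  case (Cons x xs y ys)
  have lenys: "length ys = length xs" using Cons.hyps(2) by (simp add: list_all2_lengthD)
  define w where "w = (R / \<delta>) *\<^sub>R (x - y)"
  have "u w = (R / \<delta>) *\<^sub>R (u x - u y)"
    unfolding w_def by (simp only: linear_scale[OF u] linear_diff[OF u])
  then have "norm (u w) = R / \<delta> * norm (u x - u y)"
    using R \<delta> by simp
  also have "\<dots> \<le> R / \<delta> * \<delta>"
    using Cons.hyps(1) R \<delta> by (intro mult_left_mono) auto
  finally have w: "norm (u w) \<le> R" using \<delta> by simp
  have xy: "x - y = (\<delta> / R) *\<^sub>R w" using R \<delta> by (simp add: w_def)
  have "B (zs @ x # xs) - B (zs @ y # xs) = B (zs @ (x - y) # xs)"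
    using Cons.prems(1) by (intro multilinear_on_diff[OF B, symmetric]) auto
  also have "\<dots> = (\<delta> / R) *\<^sub>R B (zs @ w # xs)"
    unfolding xy using Cons.prems(1) by (intro multilinear_on_scaleR[OF B]) auto
  finally have "norm (B (zs @ x # xs) - B (zs @ y # xs)) = \<delta> / R * norm (B (zs @ w # xs))"
    using R \<delta> by simp
  also have "\<dots> \<le> \<delta> / R * K"
    using R \<delta> w Cons.prems by (intro mult_left_mono bound) auto
  finally have 1: "norm (B (zs @ x # xs) - B (zs @ y # xs)) \<le> \<delta> / R * K" .
  have "norm (B ((zs @ [y]) @ xs) - B ((zs @ [y]) @ ys)) \<le> real (length xs) * (\<delta> / R * K)"
    using Cons.prems by (intro Cons.IH) auto
  then have 2: "norm (B (zs @ y # xs) - B (zs @ y # ys)) \<le> real (length xs) * (\<delta> / R * K)" by simp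
  have "norm (B (zs @ x # xs) - B (zs @ y # ys))
      \<le> norm (B (zs @ x # xs) - B (zs @ y # xs)) + norm (B (zs @ y # xs) - B (zs @ y # ys))"
    using norm_triangle_ineq[of "B (zs @ x # xs) - B (zs @ y # xs)" "B (zs @ y # xs) - B (zs @ y # ys)"] by simp
  also have "\<dots> \<le> \<delta> / R * K + real (length xs) * (\<delta> / R * K)"
    using 1 2 by (rule add_mono)
  finally show ?case by (simp only: length_Cons of_nat_Suc distrib_right mult_1_left)
qed

text \<open>The \<open>zs\<close> are points of the target space of \<open>u\<close>, so the
  estimate applies at limits of values of \<open>u\<close>.\<close>

lemma multilinear_on_uniformly_continuous:
  fixes B :: "'e::real_vector list \<Rightarrow> 'y::real_normed_vector" and u :: "'e \<Rightarrow> 'z::real_normed_vector"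
  assumes B: "multilinear_on m UNIV B" and u: "linear u" and K: "0 \<le> K"
    and bound: "\<And>xs R. 0 \<le> R \<Longrightarrow> length xs = m \<Longrightarrow> (\<And>x. x \<in> set xs \<Longrightarrow> norm (u x) \<le> R) \<Longrightarrow> norm (B xs) \<le> K * R ^ m"
    and zs: "length zs = m" and e: "0 < e"
  obtains \<delta> where "0 < \<delta>"
    and "\<And>xs ys. list_all2 (\<lambda>x z. norm (u x - z) < \<delta>) xs zs \<Longrightarrow> list_all2 (\<lambda>x z. norm (u x - z) < \<delta>) ys zs
      \<Longrightarrow> norm (B xs - B ys) < e"
proof -
  \<comment> \<open>The summand 1 leaves room for \<open>\<delta> \<le> 1\<close>, so that points
    near \<open>zs\<close> stay in the ball.\<close>
  define R where "R = 1 + (\<Sum>z\<leftarrow>zs. norm z)"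
  have sum: "0 \<le> (\<Sum>z\<leftarrow>zs. norm z)" by (rule sum_list_nonneg) auto
  then have R: "1 \<le> R" by (simp add: R_def)
  have R_le: "norm z + 1 \<le> R" if "z \<in> set zs" for z
  proof -
    have "norm z \<le> (\<Sum>z\<leftarrow>zs. norm z)" using that by (intro member_le_sum_list) auto
    then show ?thesis by (simp add: R_def)
  qed
  \<comment> \<open>Two lists near \<open>zs\<close> are at distance at most
    \<open>2 * \<delta>\<close>, for which the Lipschitz estimate equals
    \<open>\<delta> * c\<close>.\<close>
  define c where "c = real m * (2 * (K * R ^ m)) / R"
  have c: "0 \<le> c" using K R by (simp add: c_def)
  define \<delta> where "\<delta> = min 1 (e / (c + 1))"
  have \<delta>: "0 < \<delta>" "\<delta> \<le> 1" using e c by (auto simp: \<delta>_def)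
  have "\<delta> * c \<le> e / (c + 1) * c" using c by (intro mult_right_mono) (auto simp: \<delta>_def)
  also have "\<dots> < e" using e c by (simp add: field_simps)
  finally have \<delta>c: "\<delta> * c < e" .
  show ?thesis
  proof (rule that[OF \<delta>(1)])
    fix xs ys
    assume xs: "list_all2 (\<lambda>x z. norm (u x - z) < \<delta>) xs zs" and ys: "list_all2 (\<lambda>x z. norm (u x - z) < \<delta>) ys zs"
    have le: "norm (u x) \<le> R" if near: "list_all2 (\<lambda>x z. norm (u x - z) < \<delta>) ws zs" and x: "x \<in> set ws" for ws x
    proof -
      obtain i where i: "i < length ws" "x = ws ! i" using x by (auto simp: in_set_conv_nth)
      then have "norm (u x - zs ! i) < \<delta>" "zs ! i \<in> set zs"
        using near by (auto simp: list_all2_conv_all_nth)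
      then show ?thesis using R_le[of "zs ! i"] \<delta>(2) norm_triangle_sub[of "u x" "zs ! i"] by simp
    qed
    have close: "list_all2 (\<lambda>x y. norm (u x - u y) \<le> 2 * \<delta>) xs ys"
      unfolding list_all2_conv_all_nth
    proof (intro conjI allI impI)
      show "length xs = length ys" using xs ys by (simp add: list_all2_conv_all_nth)
      fix i assume "i < length xs"
      then have "norm (u (xs ! i) - zs ! i) < \<delta>" "norm (u (ys ! i) - zs ! i) < \<delta>"
        using xs ys by (auto simp: list_all2_conv_all_nth)
      then show "norm (u (xs ! i) - u (ys ! i)) \<le> 2 * \<delta>"
        using norm_triangle_ineq4[of "u (xs ! i) - zs ! i" "u (ys ! i) - zs ! i"] by simp
    qed
    have len: "length xs = m" using xs zs by (simp add: list_all2_conv_all_nth)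
    have "norm (B ([] @ xs) - B ([] @ ys)) \<le> real (length xs) * (2 * \<delta> / R * (K * R ^ m))"
      using R \<delta> len le[OF xs] le[OF ys] by (intro multilinear_on_lipschitz[OF B u _ _ bound close]) auto
    also have "\<dots> = \<delta> * c" by (simp add: len c_def)
    finally show "norm (B xs - B ys) < e" using \<delta>c by simp
  qed
qed

lemma subspace_closure:
  fixes S :: "'z::real_normed_vector set"
  assumes S: "subspace S"
  shows "subspace (closure S)"
proof (rule subspaceI)
  show "0 \<in> closure S" using subspace_0[OF S] closure_subset by blast
  fix x assume x: "x \<in> closure S"
  then obtain f where f: "\<And>n. f n \<in> S" "f \<longlonglongrightarrow> x" unfolding closure_sequential by blast
  show "x + y \<in> closure S" if "y \<in> closure S" for y
  proof -
    obtain g where g: "\<And>n. g n \<in> S" "g \<longlonglongrightarrow> y"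
      using \<open>y \<in> closure S\<close> unfolding closure_sequential by blast
    show ?thesis unfolding closure_sequential
      using f g by (intro exI[of _ "\<lambda>n. f n + g n"]) (simp add: subspace_add[OF S] tendsto_add)
  qed
  show "c *\<^sub>R x \<in> closure S" for c
    unfolding closure_sequential
    using f by (intro exI[of _ "\<lambda>n. c *\<^sub>R f n"]) (simp add: subspace_scale[OF S] tendsto_scaleR)
qed

text \<open>The extended form at \<open>zs\<close> is the limit of \<open>B\<close> along sequences
  whose images under \<open>u\<close> converge to \<open>zs\<close>. Uniform continuity makes these
  values Cauchy and the limit independent of the sequences. Independence is essential: the chosen
  \<open>a\<close> need not be linear, and \<open>u\<close> need not be injective.\<close>

lemma hom_polys_extension:
  fixes B :: "'e::real_vector list \<Rightarrow> 'y::banach" and u :: "'e \<Rightarrow> 'z::real_normed_vector"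
  assumes B: "multilinear_on m UNIV B" and u: "linear u" and K: "0 \<le> K"
    and bound: "\<And>xs R. 0 \<le> R \<Longrightarrow> length xs = m \<Longrightarrow> (\<And>x. x \<in> set xs \<Longrightarrow> norm (u x) \<le> R) \<Longrightarrow> norm (B xs) \<le> K * R ^ m"
  obtains Q where "Q \<in> hom_polys m (closure (range u))" and "\<And>x. Q (u x) = B (replicate m x)"
proof -
  let ?X = "closure (range u)"
  define conv where "conv = (\<lambda>f z. (\<lambda>n. u (f n)) \<longlonglongrightarrow> z)"
  have near: "\<forall>\<^sub>F n in sequentially. list_all2 (\<lambda>x z. norm (u x - z) < \<delta>) (map (\<lambda>f. f n) fs) zs"
    if fs: "list_all2 conv fs zs" and \<delta>: "0 < \<delta>" for fs zs \<delta>
    using fs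
  proof (induction fs zs rule: list_all2_induct)
    case (Cons f fs z zs)
    have "\<forall>\<^sub>F n in sequentially. norm (u (f n) - z) < \<delta>"
      using Cons.hyps(1) \<delta> unfolding conv_def tendsto_iff dist_norm by blast
    with Cons.IH show ?case by eventually_elim simp
  qed simp
  have same: "(\<lambda>n. B (map (\<lambda>f. f n) fs) - B (map (\<lambda>f. f n) gs)) \<longlonglongrightarrow> 0"
    if fs: "list_all2 conv fs zs" and gs: "list_all2 conv gs zs" and zs: "length zs = m" for fs gs zs
  proof (rule tendstoI)
    fix e :: real assume "0 < e"
    then obtain \<delta> where \<delta>: "0 < \<delta>" "\<And>xs ys. list_all2 (\<lambda>x z. norm (u x - z) < \<delta>) xs zs
        \<Longrightarrow> list_all2 (\<lambda>x z. norm (u x - z) < \<delta>) ys zs \<Longrightarrow> norm (B xs - B ys) < e"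
      using multilinear_on_uniformly_continuous[OF B u K bound zs] by blast
    show "\<forall>\<^sub>F n in sequentially. dist (B (map (\<lambda>f. f n) fs) - B (map (\<lambda>f. f n) gs)) 0 < e"
      using near[OF fs \<delta>(1)] near[OF gs \<delta>(1)] by eventually_elim (simp add: \<delta>(2))
  qed
  have cauchy: "convergent (\<lambda>n. B (map (\<lambda>f. f n) fs))"
    if fs: "list_all2 conv fs zs" and zs: "length zs = m" for fs zs
  proof (rule Cauchy_convergent, rule metric_CauchyI)
    fix e :: real assume "0 < e"
    then obtain \<delta> where \<delta>: "0 < \<delta>" "\<And>xs ys. list_all2 (\<lambda>x z. norm (u x - z) < \<delta>) xs zs
        \<Longrightarrow> list_all2 (\<lambda>x z. norm (u x - z) < \<delta>) ys zs \<Longrightarrow> norm (B xs - B ys) < e"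
      using multilinear_on_uniformly_continuous[OF B u K bound zs] by blast
    obtain N where "\<And>n. N \<le> n \<Longrightarrow> list_all2 (\<lambda>x z. norm (u x - z) < \<delta>) (map (\<lambda>f. f n) fs) zs"
      using near[OF fs \<delta>(1)] by (auto simp: eventually_sequentially)
    then show "\<exists>N. \<forall>k\<ge>N. \<forall>n\<ge>N. dist (B (map (\<lambda>f. f k) fs)) (B (map (\<lambda>f. f n) fs)) < e"
      by (intro exI[of _ N]) (simp add: dist_norm \<delta>(2))
  qed
  have "\<exists>f. conv f z" if "z \<in> ?X" for z
  proof -
    obtain g where g: "\<forall>n. g n \<in> range u" "g \<longlonglongrightarrow> z" using \<open>z \<in> ?X\<close> unfolding closure_sequential by blast
    then obtain f where "\<And>n. g n = u (f n)" unfolding image_iff by metis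
    then have "g = (\<lambda>n. u (f n))" by auto
    with g(2) show ?thesis unfolding conv_def by blast
  qed
  then obtain a where a: "\<And>z. z \<in> ?X \<Longrightarrow> conv (a z) z" by metis
  have a_list: "list_all2 conv (map a zs) zs" if "set zs \<subseteq> ?X" for zs
    using that by (induction zs) (auto simp: a)
  define A where "A = (\<lambda>zs. lim (\<lambda>n. B (map (\<lambda>f. f n) (map a zs))))"
  have A: "(\<lambda>n. B (map (\<lambda>f. f n) fs)) \<longlonglongrightarrow> A zs"
    if fs: "list_all2 conv fs zs" and zs: "length zs = m" and X: "set zs \<subseteq> ?X" for fs zs
  proof -
    have "(\<lambda>n. B (map (\<lambda>f. f n) (map a zs))) \<longlonglongrightarrow> A zs"
      unfolding A_def using cauchy[OF a_list[OF X] zs] by (simp only: convergent_LIMSEQ_iff)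
    from tendsto_add[OF same[OF fs a_list[OF X] zs] this] show ?thesis by simp
  qed
  have subspace: "subspace ?X"
    using u by (intro subspace_closure linear_subspace_image) auto
  have "multilinear_on m ?X A"
    unfolding multilinear_on_def
  proof (intro allI impI conjI ballI)
    fix xs ys assume len: "length xs + length ys + 1 = m" and xs: "set xs \<subseteq> ?X" and ys: "set ys \<subseteq> ?X"
    have slot: "(\<lambda>n. B (map (\<lambda>f. f n) (map a xs) @ f n # map (\<lambda>f. f n) (map a ys))) \<longlonglongrightarrow> A (xs @ z # ys)"
      if "conv f z" "z \<in> ?X" for f z
    proof -
      have "list_all2 conv (map a xs @ f # map a ys) (xs @ z # ys)"
        using a_list[OF xs] a_list[OF ys] that(1) by (intro list_all2_appendI) auto
      from A[OF this] show ?thesis using len xs ys that(2) by simp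
    qed
    show "A (xs @ (b + c) # ys) = A (xs @ b # ys) + A (xs @ c # ys)" if b: "b \<in> ?X" and c: "c \<in> ?X" for b c
    proof (rule LIMSEQ_unique)
      have "conv (\<lambda>n. a b n + a c n) (b + c)"
        using tendsto_add[OF a[OF b, unfolded conv_def] a[OF c, unfolded conv_def]]
        by (simp add: conv_def linear_add[OF u])
      then show "(\<lambda>n. B (map (\<lambda>f. f n) (map a xs) @ (a b n + a c n) # map (\<lambda>f. f n) (map a ys)))
          \<longlonglongrightarrow> A (xs @ (b + c) # ys)"
        using b c subspace by (intro slot subspace_add)
      show "(\<lambda>n. B (map (\<lambda>f. f n) (map a xs) @ (a b n + a c n) # map (\<lambda>f. f n) (map a ys)))
          \<longlonglongrightarrow> A (xs @ b # ys) + A (xs @ c # ys)"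
        using tendsto_add[OF slot[OF a[OF b] b] slot[OF a[OF c] c]] len
        by (subst multilinear_on_add[OF B]) auto
    qed
    show "A (xs @ (r *\<^sub>R b) # ys) = r *\<^sub>R A (xs @ b # ys)" if b: "b \<in> ?X" for r b
    proof (rule LIMSEQ_unique)
      have "conv (\<lambda>n. r *\<^sub>R a b n) (r *\<^sub>R b)"
        using tendsto_scaleR[OF tendsto_const[of r] a[OF b, unfolded conv_def]]
        by (simp add: conv_def linear_scale[OF u])
      then show "(\<lambda>n. B (map (\<lambda>f. f n) (map a xs) @ (r *\<^sub>R a b n) # map (\<lambda>f. f n) (map a ys)))
          \<longlonglongrightarrow> A (xs @ (r *\<^sub>R b) # ys)"
        using b subspace by (intro slot subspace_scale)
      show "(\<lambda>n. B (map (\<lambda>f. f n) (map a xs) @ (r *\<^sub>R a b n) # map (\<lambda>f. f n) (map a ys)))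
          \<longlonglongrightarrow> r *\<^sub>R A (xs @ b # ys)"
        using tendsto_scaleR[OF tendsto_const[of r] slot[OF a[OF b] b]] len
        by (subst multilinear_on_scaleR[OF B]) auto
    qed
  qed
  moreover have "continuous_on ?X (\<lambda>z. A (replicate m z))"
    unfolding continuous_on_iff
  proof (intro ballI allI impI)
    fix z and e :: real assume z: "z \<in> ?X" and e: "0 < e"
    have diag: "(\<lambda>n. B (map (\<lambda>f. f n) (replicate m (a x)))) \<longlonglongrightarrow> A (replicate m x)" if "x \<in> ?X" for x
      using that a by (intro A) (auto simp: list_all2_conv_all_nth)
    \<comment> \<open>Passing to the limit preserves only the weak inequality, hence
      \<open>e / 2\<close>.\<close>
    obtain \<delta> where \<delta>: "0 < \<delta>" "\<And>xs ys. list_all2 (\<lambda>x z. norm (u x - z) < \<delta>) xs (replicate m z)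
        \<Longrightarrow> list_all2 (\<lambda>x z. norm (u x - z) < \<delta>) ys (replicate m z) \<Longrightarrow> norm (B xs - B ys) < e / 2"
      using multilinear_on_uniformly_continuous[OF B u K bound, of "replicate m z" "e / 2"] e
      by (metis half_gt_zero length_replicate)
    have ev: "\<forall>\<^sub>F n in sequentially. list_all2 (\<lambda>x z. norm (u x - z) < \<delta>) (map (\<lambda>f. f n) (replicate m (a x))) (replicate m z)"
      if x: "x \<in> ?X" and d: "dist x z < \<delta>" for x
    proof -
      have "(\<lambda>n. norm (u (a x n) - z)) \<longlonglongrightarrow> norm (x - z)"
        using a[OF x] unfolding conv_def by (intro tendsto_intros)
      then have "\<forall>\<^sub>F n in sequentially. norm (u (a x n) - z) < \<delta>"
        using d by (intro order_tendstoD) (auto simp: dist_norm)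
      then show ?thesis by eventually_elim (auto simp: list_all2_conv_all_nth)
    qed
    have "dist (A (replicate m x)) (A (replicate m z)) < e" if x: "x \<in> ?X" and d: "dist x z < \<delta>" for x
    proof -
      have "(\<lambda>n. norm (B (map (\<lambda>f. f n) (replicate m (a x))) - B (map (\<lambda>f. f n) (replicate m (a z)))))
          \<longlonglongrightarrow> norm (A (replicate m x) - A (replicate m z))"
        using diag[OF x] diag[OF z] by (intro tendsto_intros)
      moreover have "\<forall>\<^sub>F n in sequentially.
          norm (B (map (\<lambda>f. f n) (replicate m (a x))) - B (map (\<lambda>f. f n) (replicate m (a z)))) \<le> e / 2"
        using ev[OF x d] ev[OF z, unfolded dist_self, OF \<delta>(1)]
        by eventually_elim (rule less_imp_le, rule \<delta>(2))
      ultimately have "norm (A (replicate m x) - A (replicate m z)) \<le> e / 2"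
        by (rule tendsto_upperbound) simp
      then show ?thesis using e by (simp add: dist_norm)
    qed
    then show "\<exists>d>0. \<forall>x\<in>?X. dist x z < d \<longrightarrow> dist (A (replicate m x)) (A (replicate m z)) < e"
      using \<delta>(1) by (intro exI[of _ \<delta>]) simp
  qed
  ultimately have "(\<lambda>z. A (replicate m z)) \<in> hom_polys m ?X"
    unfolding hom_polys_def by (intro CollectI conjI exI[of _ A]) simp_all
  moreover have "A (replicate m (u x)) = B (replicate m x)" for x
  proof -
    have "u x \<in> ?X"
      using closure_subset[of "range u"] by blast
    then have ux: "set (replicate m (u x)) \<subseteq> ?X"
      by (simp add: set_replicate_conv_if)
    \<comment> \<open>By independence of the approximating sequences, the constant sequence may be
      used at \<open>u x\<close>.\<close>
    have "list_all2 conv (replicate m (\<lambda>n. x)) (replicate m (u x))"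
      by (simp add: list_all2_conv_all_nth conv_def)
    from A[OF this _ ux] have "(\<lambda>n. B (replicate m x)) \<longlonglongrightarrow> A (replicate m (u x))"
      by (simp add: map_replicate)
    then show ?thesis by (simp add: LIMSEQ_const_iff)
  qed
  ultimately show ?thesis by (rule that)
qed

section \<open>Assembling the factorization\<close>

lemma hom_polys_scale:
  assumes "P \<in> hom_polys m X"
  shows "(\<lambda>x. c *\<^sub>R P x) \<in> hom_polys m X"
proof -
  obtain A where A: "multilinear_on m X A" "\<And>x. x \<in> X \<Longrightarrow> P x = A (replicate m x)"
    using assms by (auto simp: hom_polys_def)
  have "multilinear_on m X (\<lambda>xs. c *\<^sub>R A xs)"
    using A(1) unfolding multilinear_on_def by (simp add: scaleR_add_right mult.commute)
  then show ?thesis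
    using assms A(2) unfolding hom_polys_def
    by (intro CollectI conjI exI[of _ "\<lambda>xs. c *\<^sub>R A xs"] continuous_on_scaleR continuous_on_const) auto
qed

lemma positive_dominated_subset_poly_factorization:
  assumes m: "1 \<le> m" and p: "1 \<le> p"
  shows "(positive_dominated m p :: ('e::banach_lattice \<Rightarrow> 'y::banach) set)
    \<subseteq> poly_factorization m (positive_summing p :: 'e linfty set \<Rightarrow> ('e \<Rightarrow> 'e linfty) set)"
proof
  fix P :: "'e \<Rightarrow> 'y" assume "P \<in> positive_dominated m p"
  then have P: "P \<in> hom_polys m UNIV" "cone_summing (p / real m) p P"
    by (auto simp: positive_dominated_eq[OF m p])
  obtain A where A: "multilinear_on m UNIV A" "\<And>x. P x = A (replicate m x)"
    using P(1) by (auto simp: hom_polys_def)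
  have hom: "P (t *\<^sub>R x) = t ^ m *\<^sub>R P x" for t x
    using hom_polys_homogeneous[OF P(1)] by simp
  obtain q C where q_add: "\<And>x y. q (x + y) \<le> q x + q y"
    and q_scale: "\<And>t x. q (t *\<^sub>R x) = \<bar>t\<bar> * q x"
    and q_norm: "\<And>x. q x \<le> norm x"
    and q_mono: "\<And>x y. \<bar>x\<bar> \<le> \<bar>y\<bar> \<Longrightarrow> q x \<le> q y"
    and q_summing: "\<And>xs. (\<And>x. x \<in> set xs \<Longrightarrow> 0 \<le> x) \<Longrightarrow> (\<Sum>x\<leftarrow>xs. q x powr p) \<le> weak_moment p xs"
    and C: "0 \<le> C" "\<And>x. 0 \<le> x \<Longrightarrow> norm (P x) \<le> C * q x ^ m"
    using pietsch_domination[OF m p P(2) hom] by blast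
  have q_zero: "q 0 = 0" using q_scale[of 0 0] by simp
  obtain u :: "'e \<Rightarrow> 'e linfty" where u: "linear u" "\<And>x. norm (u x) = q x"
    using seminorm_embedding[OF q_add q_scale] by blast
  have bl: "bounded_linear u"
    using u q_norm by (intro bounded_linear_intro[of u 1]) (auto simp: linear_add linear_scale)
  have "cone_summing p p u"
    by (rule cone_summingI[of _ _ 1]) (simp add: u q_summing)
  then have summing: "u \<in> positive_summing p (closure (range u))"
    using bl closure_subset[of "range u"] by (simp add: positive_summing_eq[OF p])
  define K where "K = 2 ^ m * (2 ^ m * C * real m ^ m)"
  have "norm (polarization m A xs) \<le> K * R ^ m"
    if "0 \<le> R" "length xs = m" "\<And>x. x \<in> set xs \<Longrightarrow> norm (u x) \<le> R" for xs R
    unfolding K_def using that by (intro polarization_bound[OF A C q_add q_zero q_mono]) (auto simp: u)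
  moreover have "0 \<le> K" using C(1) by (simp add: K_def)
  ultimately obtain Q where Q: "Q \<in> hom_polys m (closure (range u))"
      "\<And>x. Q (u x) = polarization m A (replicate m x)"
    using hom_polys_extension[OF multilinear_on_polarization[OF A(1)] u(1)] by metis
  \<comment> \<open>Undoes the factor \<open>fact m\<close> in \<open>polarization\<close>.\<close>
  define Q' where "Q' = (\<lambda>z. (1 / fact m) *\<^sub>R Q z)"
  have "Q' \<in> hom_polys m (closure (range u))"
    unfolding Q'_def using Q(1) by (rule hom_polys_scale)
  moreover have "P = Q' \<circ> u"
    by (simp add: fun_eq_iff Q'_def Q(2) polarization_replicate A(2))
  moreover have "subspace (closure (range u))"
    using u(1) by (intro subspace_closure linear_subspace_image) auto
  ultimately show "P \<in> poly_factorization m (positive_summing p :: 'e linfty set \<Rightarrow> ('e \<Rightarrow> 'e linfty) set)"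
    unfolding poly_factorization_def using P(1) summing by blast
qed

text \<open>The inclusion for an arbitrary type \<open>'x\<close> says that no intermediate Banach
  space leads outside the dominated polynomials; the equality says that closed subspaces of
  \<open>'e linfty\<close> already produce all of them.\<close>

theorem corollary3p6:
  fixes m :: nat and p :: real
  assumes "1 \<le> m" and "1 \<le> p"
  shows "positive_right_polynomial_ideal m
           (positive_dominated m p :: ('e::banach_lattice \<Rightarrow> 'y::banach) set)
           (positive_dominated m p :: ('g::banach_lattice \<Rightarrow> 'z::banach) set)
       \<and> poly_factorization m (positive_summing p :: 'x::banach set \<Rightarrow> ('e \<Rightarrow> 'x) set)
           \<subseteq> (positive_dominated m p :: ('e \<Rightarrow> 'y) set)
       \<and> (positive_dominated m p :: ('e \<Rightarrow> 'y) set)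
           = poly_factorization m (positive_summing p :: 'e linfty set \<Rightarrow> ('e \<Rightarrow> 'e linfty) set)"
  by (intro conjI equalityI positive_dominated_ideal poly_factorization_subset_dominated
      positive_dominated_subset_poly_factorization assms)

end
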